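(* Let $p$ be an odd prime. Let $L$ be a non-split link which admits non-trivial $p$-colorings. Then $\mathrm{maxcol}_p L = p$.
   Context: Links are classical links in $3$-space. A split link is a link which can be made (by isotopy) to be contained in two disjoint balls in $3$-space, with part of the link in each ball; a non-split link is a link which is not split. For an integer $p>1$ and a diagram $D$ of a link $L$, a $p$-coloring of $D$ is an assignment of integers modulo $p$ (called colors) to the arcs of $D$ such that at each crossing, twice the color of the over-arc equals the sum of the colors of the two under-arcs, modulo $p$. A $p$-coloring is trivial if all arcs of the diagram receive the same color, and non-trivial if it uses more than one color. Whether a link admits non-trivial $p$-colorings does not depend on the diagram. Suppose $L$ admits non-trivial $p$-colorings. For a diagram $D$ of $L$, let $n_{p,L}(D)$ be the maximum number of distinct colors used in a non-trivial $p$-coloring of $D$. Define $\mathrm{maxcol}_p L := \max\{ n_{p,L}(D) \mid D \text{ is a diagram of } L\}$. *)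

theory Defs
  imports "HOL-Analysis.Analysis" "HOL-Number_Theory.Number_Theory"
begin

type_synonym r3 = "real^3"

text \<open>
  Links are tame and unoriented, and are considered up to ambient isotopy of 3-space.
  A finite disjoint union of simple closed curves is a compact set, and these curves are its
  connected components.
\<close>

definition closed_curves :: "r3 set \<Rightarrow> bool" where
  "closed_curves L \<longleftrightarrow> L \<noteq> {} \<and> finite (components L) \<and>
     (\<forall>K\<in>components L. K homeomorphic sphere (0::real^2) 1)"

definition ambient_isotopic :: "r3 set \<Rightarrow> r3 set \<Rightarrow> bool" where
  "ambient_isotopic L M \<longleftrightarrow>
     (\<exists>h. homotopic_with_canon (\<lambda>f. \<exists>g. homeomorphism UNIV UNIV f g) UNIV UNIV id h \<and> h ` L = M)"

definition polygonal_link :: "r3 set \<Rightarrow> bool" where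
  "polygonal_link L \<longleftrightarrow> closed_curves L \<and>
     (\<exists>S. finite S \<and> L = (\<Union>(a, b)\<in>S. closed_segment a b))"

definition link :: "r3 set \<Rightarrow> bool" where
  "link L \<longleftrightarrow> closed_curves L \<and> (\<exists>P. polygonal_link P \<and> ambient_isotopic L P)"

definition split_link :: "r3 set \<Rightarrow> bool" where
  "split_link L \<longleftrightarrow> (\<exists>M a r b s. ambient_isotopic L M \<and>
     cball a r \<inter> cball b s = {} \<and> M \<subseteq> cball a r \<union> cball b s \<and>
     M \<inter> cball a r \<noteq> {} \<and> M \<inter> cball b s \<noteq> {})"

text \<open>
  A diagram is the projection to the plane of the first two coordinates of a polygonal link in
  regular position, with the over/under information at the double points given by the third
  coordinate. It is represented by that polygonal link itself.
\<close>

definition plane_proj :: "r3 \<Rightarrow> real \<times> real" where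
  "plane_proj x = (x $ 1, x $ 2)"

text \<open>A crossing is the pair of its upper point and its lower point on the link.\<close>

definition crossings :: "r3 set \<Rightarrow> (r3 \<times> r3) set" where
  "crossings D = {(x, u). x \<in> D \<and> u \<in> D \<and> plane_proj x = plane_proj u \<and> x $ 3 > u $ 3}"

text \<open>The points of a polygonal link that are not corners are those where it is locally a line.\<close>

definition straight_at :: "r3 set \<Rightarrow> r3 \<Rightarrow> bool" where
  "straight_at D x \<longleftrightarrow>
     (\<exists>v r. v \<noteq> 0 \<and> r > 0 \<and> D \<inter> ball x r = range (\<lambda>t. x + t *\<^sub>R v) \<inter> ball x r)"

text \<open>
  Regular position: finitely many multiple points, all of them double points, none of them the
  image of a corner. Finiteness rules out vertical edges and overlapping edges, so that the two
  strands meet transversally at each double point.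
\<close>

definition link_diagram :: "r3 set \<Rightarrow> bool" where
  "link_diagram D \<longleftrightarrow> polygonal_link D \<and> finite (crossings D) \<and>
     (\<forall>x\<in>D. \<forall>y\<in>D. \<forall>z\<in>D. plane_proj x = plane_proj y \<and> plane_proj y = plane_proj z
        \<longrightarrow> x = y \<or> y = z \<or> x = z) \<and>
     (\<forall>(x, u)\<in>crossings D. straight_at D x \<and> straight_at D u)"

definition diagram_of :: "r3 set \<Rightarrow> r3 set \<Rightarrow> bool" where
  "diagram_of D L \<longleftrightarrow> link_diagram D \<and> ambient_isotopic L D"

text \<open>
  Arcs run from one undercrossing to the next; a component of the link without undercrossings
  is a single (closed) arc.
\<close>

definition arcs :: "r3 set \<Rightarrow> r3 set set" where
  "arcs D = components (D - snd ` crossings D)"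

text \<open>
  The arcs \<open>A\<close> and \<open>B\<close> are the ones leaving the lower point \<open>u\<close> of a crossing in the two opposite
  directions. They may coincide, in which case the color of this arc counts twice in the
  coloring condition.
\<close>

definition under_arcs :: "r3 \<Rightarrow> r3 set \<Rightarrow> r3 set \<Rightarrow> bool" where
  "under_arcs u A B \<longleftrightarrow>
     (\<exists>v. v \<noteq> 0 \<and> (\<forall>\<^sub>F t in at_right 0. u + t *\<^sub>R v \<in> A \<and> u - t *\<^sub>R v \<in> B))"

text \<open>
  The integers modulo \<open>p\<close> are represented by their residues in \<open>{0..<p}\<close>. Only the values on
  the arcs matter.
\<close>

definition coloring :: "nat \<Rightarrow> r3 set \<Rightarrow> (r3 set \<Rightarrow> int) \<Rightarrow> bool" where
  "coloring p D c \<longleftrightarrow> (\<forall>A\<in>arcs D. c A \<in> {0..<int p}) \<and>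
     (\<forall>(x, u)\<in>crossings D. \<forall>C\<in>arcs D. \<forall>A\<in>arcs D. \<forall>B\<in>arcs D.
        x \<in> C \<and> under_arcs u A B \<longrightarrow> [2 * c C = c A + c B] (mod int p))"

definition nontrivial_coloring :: "nat \<Rightarrow> r3 set \<Rightarrow> (r3 set \<Rightarrow> int) \<Rightarrow> bool" where
  "nontrivial_coloring p D c \<longleftrightarrow> coloring p D c \<and> card (c ` arcs D) > 1"

text \<open>
  Having non-trivial \<open>p\<close>-colorings does not depend on the diagram, so it suffices to ask for
  one diagram.
\<close>

definition admits_nontrivial_colorings :: "nat \<Rightarrow> r3 set \<Rightarrow> bool" where
  "admits_nontrivial_colorings p L \<longleftrightarrow> (\<exists>D c. diagram_of D L \<and> nontrivial_coloring p D c)"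

text \<open>
  At most \<open>p\<close> colors are used, so this supremum is the maximum of the set if the diagram has
  non-trivial \<open>p\<close>-colorings; otherwise it is \<open>0\<close>.
\<close>

definition max_colors_diagram :: "nat \<Rightarrow> r3 set \<Rightarrow> nat" where
  "max_colors_diagram p D = Sup {card (c ` arcs D) | c. nontrivial_coloring p D c}"

definition maxcol :: "nat \<Rightarrow> r3 set \<Rightarrow> nat" where
  "maxcol p L = Max {max_colors_diagram p D | D. diagram_of D L}"

end

theory Submission
  imports Defs
begin

text \<open>
At most \<open>p\<close> residues exist, so the content is a diagram of \<open>L\<close> with a coloring that uses all of them.

A crossing whose strands carry two different colors is needed to begin with. If no crossing had
one, the color of a point would be locally constant along the whole link and would agree at the two
points of each crossing. The points of one fixed color and the other points would then be two
compact parts with disjoint shadows. Lifting one part vertically moves the parts into disjoint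
balls, so the link would be split (\<open>split_linkI\<close>, \<open>bichromatic_crossing\<close>).

Colors are then added one at a time. Let the upper strand of a crossing have color \<open>a\<close> and one of
the lower arcs color \<open>b\<close>. Pull a finger of that lower arc over the upper strand (a Reidemeister
move of type two). This cuts a short piece out of the upper strand, and the piece must get the
color \<open>2 * b - a\<close>; all other colors survive. At a new crossing the upper strand has color \<open>b\<close> and a
lower arc has color \<open>2 * b - a\<close>, the next term of the arithmetic progression through \<open>a\<close> and \<open>b\<close>, so
the move can be repeated there (\<open>add_color\<close>, \<open>progression_of_colors\<close>). As \<open>p\<close> is prime and
\<open>a \<noteq> b\<close>, the progression runs through all residues (\<open>progression_mod_prime\<close>).

The finger move is made explicit in affine coordinates around the crossing
(\<open>crossing_chart_exists\<close>) in which the two strands are coordinate lines and no other part of the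
link has its shadow nearby. The move is the identity plus a contraction with values in one fixed
direction, conjugated by an affine map. Banach's fixed point theorem makes the identity plus a
contraction a homeomorphism, and shrinking the contraction to zero gives the isotopy
(\<open>bump_isotopy\<close>). Its effect on the link is to replace a segment by the other two sides of
a triangle.
\<close>

section \<open>Ambient isotopies\<close>

lemma ambient_isotopic_trans:
  assumes "ambient_isotopic L M" "ambient_isotopic M N"
  shows "ambient_isotopic L N"
proof -
  let ?P = "\<lambda>f::r3 \<Rightarrow> r3. \<exists>g. homeomorphism UNIV UNIV f g"
  obtain h where h: "homotopic_with_canon ?P UNIV UNIV id h" "h ` L = M"
    using assms(1) unfolding ambient_isotopic_def by blast
  obtain k where k: "homotopic_with_canon ?P UNIV UNIV id k" "k ` M = N"
    using assms(2) unfolding ambient_isotopic_def by blast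
  have hP: "?P h"
    using homotopic_with_imp_property[OF h(1)] by blast
  have hc: "continuous_map (top_of_set UNIV) (top_of_set UNIV) h"
    using homotopic_with_imp_continuous_maps[OF h(1)] by blast
  have "homotopic_with_canon ?P UNIV UNIV (id \<circ> h) (k \<circ> h)"
    by (rule homotopic_with_compose_continuous_map_right[OF k(1) hc])
      (use hP homeomorphism_compose in blast)
  then have "homotopic_with_canon ?P UNIV UNIV id (k \<circ> h)"
    using homotopic_with_trans[OF h(1)] by simp
  moreover have "(k \<circ> h) ` L = N"
    using h(2) k(2) image_comp[of k h L] by simp
  ultimately show ?thesis
    unfolding ambient_isotopic_def by blast
qed

lemma ambient_isotopicI:
  fixes H :: "real \<Rightarrow> r3 \<Rightarrow> r3"
  assumes cont: "continuous_on UNIV (\<lambda>(t, x). H t x)"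
    and start: "\<And>x. H 0 x = x"
    and homeo: "\<And>t. 0 \<le> t \<Longrightarrow> t \<le> 1 \<Longrightarrow> \<exists>g. homeomorphism UNIV UNIV (H t) g"
  shows "ambient_isotopic L (H 1 ` L)"
proof -
  let ?P = "\<lambda>f::r3 \<Rightarrow> r3. \<exists>g. homeomorphism UNIV UNIV f g"
  have "homotopic_with_canon ?P UNIV UNIV id (H 1)"
    unfolding homotopic_with_def
  proof (rule exI[of _ "\<lambda>(t, x). H t x"], intro conjI allI ballI)
    show "continuous_map (prod_topology (top_of_set {0..1}) (top_of_set UNIV)) (top_of_set UNIV)
        (\<lambda>(t, x). H t x)"
      unfolding prod_topology_subtopology_eu
      using continuous_on_subset[OF cont, of "{0..1} \<times> UNIV"] by simp
  qed (use start homeo in auto)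
  then show ?thesis
    unfolding ambient_isotopic_def by blast
qed

lemma homeomorphism_UNIV_I:
  assumes "continuous_on UNIV f" "continuous_on UNIV g" "\<And>x. g (f x) = x" "\<And>y. f (g y) = y"
  shows "homeomorphism UNIV UNIV f g"
proof -
  have "range f = UNIV" "range g = UNIV"
    using assms(3,4) by (metis surjI)+
  then show ?thesis
    using assms by (simp add: homeomorphism_def)
qed

text \<open>
  Solving \<open>x + f x = y\<close> for \<open>x\<close> is a fixed point problem for the contraction \<open>\<lambda>x. y - f x\<close>, and
  the estimate that makes \<open>x \<mapsto> x + f x\<close> expanding up to a factor makes the inverse Lipschitz.
\<close>

lemma homeomorphism_id_plus_contraction:
  fixes f :: "'a::{real_normed_vector, complete_space} \<Rightarrow> 'a"
  assumes c: "0 \<le> c" "c < 1"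
    and lip: "\<And>x y. norm (f x - f y) \<le> c * norm (x - y)"
  shows "\<exists>g. homeomorphism UNIV UNIV (\<lambda>x. x + f x) g"
proof -
  have expand: "(1 - c) * norm (x - y) \<le> norm ((x + f x) - (y + f y))" for x y
  proof -
    have "norm (x - y) = norm (((x + f x) - (y + f y)) - (f x - f y))"
      by (simp add: algebra_simps)
    also have "\<dots> \<le> norm ((x + f x) - (y + f y)) + norm (f x - f y)"
      by (rule norm_triangle_ineq4)
    finally show ?thesis
      using lip[of x y] by (simp add: algebra_simps)
  qed
  have ex: "\<exists>x. x + f x = y" for y
  proof -
    have "\<exists>!x. y - f x = x"
    proof (rule banach_fix_type[OF c], intro allI)
      fix a b
      have "norm ((y - f a) - (y - f b)) = norm (f a - f b)"
        by (simp add: norm_minus_commute)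
      then show "dist (y - f a) (y - f b) \<le> c * dist a b"
        using lip[of a b] by (simp add: dist_norm)
    qed
    then obtain x where "y - f x = x" by blast
    then have "x + f x = y" by (simp add: algebra_simps)
    then show ?thesis ..
  qed
  define g where "g y = (SOME x. x + f x = y)" for y
  have g: "g y + f (g y) = y" for y
    unfolding g_def by (rule someI_ex[OF ex])
  have gf: "g (x + f x) = x" for x
    using expand[of "g (x + f x)" x] g[of "x + f x"] c by (simp add: mult_le_0_iff)
  have "lipschitz_on (1 / (1 - c)) UNIV g"
  proof (rule lipschitz_onI)
    fix a b
    have "(1 - c) * norm (g a - g b) \<le> norm (a - b)"
      using expand[of "g a" "g b"] by (simp add: g)
    then show "dist (g a) (g b) \<le> 1 / (1 - c) * dist a b"
      using c by (simp add: dist_norm field_simps)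
  qed (use c in simp)
  moreover have "lipschitz_on c UNIV f"
    by (rule lipschitz_onI) (use lip c in \<open>simp_all add: dist_norm\<close>)
  ultimately have "continuous_on UNIV g" "continuous_on UNIV f"
    by (auto intro: lipschitz_on_continuous_on)
  then have "homeomorphism UNIV UNIV (\<lambda>x. x + f x) g"
    by (intro homeomorphism_UNIV_I continuous_intros g gf)
  then show ?thesis by blast
qed

text \<open>
  A pyramid-shaped displacement in direction \<open>e\<close>, supported on the unit ball. On a diameter
  orthogonal to \<open>e\<close> it has the shape of a tent, so that \<open>y \<mapsto> y + bump e y\<close> replaces this diameter by two
  segments through the apex \<open>e / 2\<close>. The factor one half makes it a contraction for unit vectors \<open>e\<close>.
\<close>

definition bump :: "'a \<Rightarrow> 'a::real_normed_vector \<Rightarrow> 'a" where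
  "bump e y = (max 0 (1 - norm y) / 2) *\<^sub>R e"

lemma bump_lipschitz:
  assumes "norm e = 1"
  shows "norm (bump e x - bump e y) \<le> 1 / 2 * norm (x - y)"
proof -
  have "\<bar>max 0 (1 - norm x) - max 0 (1 - norm y)\<bar> \<le> norm (x - y)"
    using norm_triangle_ineq3[of x y] by (auto simp: max_def)
  moreover have "norm (bump e x - bump e y) = \<bar>max 0 (1 - norm x) - max 0 (1 - norm y)\<bar> / 2"
    unfolding bump_def using assms by (simp flip: scaleR_diff_left add: diff_divide_distrib[symmetric])
  ultimately show ?thesis by simp
qed

text \<open>
  The homeomorphism \<open>A\<close> transports the bump from the unit ball to any region that is needed. For each
  time \<open>t\<close> between zero and one, \<open>t\<close> times the bump is still a contraction.
\<close>

lemma bump_isotopy: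
  fixes A B :: "r3 \<Rightarrow> r3"
  assumes A: "homeomorphism UNIV UNIV A B" and e: "norm e = 1"
  defines "h \<equiv> \<lambda>x. A (B x + bump e (B x))"
  shows "ambient_isotopic D (h ` D)" "\<exists>g. homeomorphism UNIV UNIV h g"
proof -
  define H where "H t = A \<circ> (\<lambda>y. y + t *\<^sub>R bump e y) \<circ> B" for t
  have AB: "continuous_on UNIV A" "continuous_on UNIV B" "A (B x) = x" "B (A x) = x" for x
    using A by (auto simp: homeomorphism_def)
  have homeo: "\<exists>g. homeomorphism UNIV UNIV (H t) g" if "0 \<le> t" "t \<le> 1" for t
  proof -
    have "\<exists>g. homeomorphism UNIV UNIV (\<lambda>y. y + t *\<^sub>R bump e y) g"
    proof (rule homeomorphism_id_plus_contraction)
      fix x y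
      have "norm (t *\<^sub>R bump e x - t *\<^sub>R bump e y) = t * norm (bump e x - bump e y)"
        using that by (simp flip: scaleR_diff_right)
      also have "\<dots> \<le> 1 * norm (bump e x - bump e y)"
        by (rule mult_right_mono) (use that in auto)
      also have "\<dots> \<le> 1 / 2 * norm (x - y)"
        using bump_lipschitz[OF e] by simp
      finally show "norm (t *\<^sub>R bump e x - t *\<^sub>R bump e y) \<le> 1 / 2 * norm (x - y)" .
    qed auto
    then obtain g where g: "homeomorphism UNIV UNIV (\<lambda>y. y + t *\<^sub>R bump e y) g" ..
    show ?thesis
      unfolding H_def o_assoc[symmetric]
      using homeomorphism_compose[OF homeomorphism_compose[OF homeomorphism_symD[OF A] g] A] by blast
  qed
  have hH: "H 1 = h"
    by (auto simp: H_def h_def)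
  have "ambient_isotopic D (H 1 ` D)"
  proof (rule ambient_isotopicI[OF _ _ homeo])
    have cB: "continuous_on X B" "continuous_on Y A" for X Y
      using AB(1,2) continuous_on_subset by blast+
    have "continuous_on UNIV (\<lambda>p::real \<times> r3. A (B (snd p) + fst p *\<^sub>R bump e (B (snd p))))"
      unfolding bump_def
      by (intro continuous_intros continuous_on_compose2[OF cB(2)[of UNIV]]
          continuous_on_compose2[OF cB(1)[of UNIV]]) auto
    then show "continuous_on UNIV (\<lambda>(t, x). H t x)"
      by (simp add: H_def case_prod_unfold)
  qed (auto simp: H_def AB)
  then show "ambient_isotopic D (h ` D)" by (simp add: hH)
  show "\<exists>g. homeomorphism UNIV UNIV h g" using homeo[of 1] hH by simp
qed

lemma continuous_on_plane_proj: "continuous_on X plane_proj"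
  unfolding plane_proj_def by (intro continuous_intros)

text \<open>
  A vertical shift by an amount depending only on the shadow of a point is undone by the opposite shift.
\<close>

lemma lift_isotopy:
  fixes f :: "real \<times> real \<Rightarrow> real"
  assumes f: "continuous_on UNIV f"
  shows "ambient_isotopic D ((\<lambda>x. x + f (plane_proj x) *\<^sub>R axis 3 1) ` D)"
proof -
  define H where "H t x = x + (t * f (plane_proj x)) *\<^sub>R axis 3 1" for t :: real and x :: r3
  have cont: "continuous_on UNIV (\<lambda>p. H (fst p) (snd p))"
    unfolding H_def
    by (intro continuous_intros continuous_on_compose2[OF f] 
        continuous_on_compose2[OF continuous_on_plane_proj[of UNIV]]) auto
  have contt: "continuous_on UNIV (H t)" for t
    proof -
    have "continuous_on UNIV (Pair t :: r3 \<Rightarrow> _)"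
      by (intro continuous_intros)
    from continuous_on_compose2[OF cont this] show ?thesis by simp
  qed
  have [simp]: "plane_proj (x + c *\<^sub>R axis 3 1) = plane_proj x"
    "plane_proj (x - c *\<^sub>R axis 3 1) = plane_proj x" for x c
    by (simp_all add: plane_proj_def axis_def)
  have inv: "H t (H (-t) x) = x" for t x
    by (simp add: H_def)
  have "ambient_isotopic D (H 1 ` D)"
  proof (rule ambient_isotopicI)
    show "continuous_on UNIV (\<lambda>(t, x). H t x)" using cont by (simp add: case_prod_unfold)
    show "\<exists>g. homeomorphism UNIV UNIV (H t) g" for t
      by (rule exI[of _ "H (-t)"]) (rule homeomorphism_UNIV_I, use contt inv[of t] inv[of "-t"] in auto)
  qed (simp add: H_def)
  then show ?thesis by (simp add: H_def[abs_def])
qed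

section \<open>Components and finite unions of segments\<close>

lemma components_homeomorphic_image:
  assumes h: "homeomorphism UNIV UNIV h g" and K: "K \<in> components S"
  shows "h ` K \<in> components (h ` S)"
proof -
  have hg: "continuous_on X h" "continuous_on Y g" "g (h x) = x" "h (g y) = y" for X Y x y
    using h continuous_on_subset[of UNIV h X] continuous_on_subset[of UNIV g Y]
    by (simp_all add: homeomorphism_def)
  show ?thesis
    unfolding in_components_maximal
  proof (intro conjI allI impI)
    show "h ` K \<noteq> {}" "h ` K \<subseteq> h ` S" "connected (h ` K)"
      using in_components_nonempty[OF K] in_components_subset[OF K] in_components_connected[OF K]
      by (auto intro!: connected_continuous_image hg(1))
    fix T assume T: "T \<noteq> {} \<and> h ` K \<subseteq> T \<and> T \<subseteq> h ` S \<and> connected T"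
    then have "connected (g ` T)" "g ` T \<noteq> {}"
      by (auto intro!: connected_continuous_image hg(2))
    moreover have "g ` T \<subseteq> S"
    proof
      fix y assume "y \<in> g ` T"
      then obtain t where "t \<in> T" "y = g t" by auto
      moreover obtain s where "s \<in> S" "t = h s" using T \<open>t \<in> T\<close> by blast
      ultimately have "s \<in> S" "y = g (h s)" by auto
      then show "y \<in> S" by (simp add: hg(3))
    qed
    moreover have "K \<subseteq> g ` T"
    proof
      fix y assume "y \<in> K"
      then have "h y \<in> T" using T by auto
      then show "y \<in> g ` T" using hg(3)[of y] by (metis imageI)
    qed
    ultimately have "connected (g ` T)" "g ` T \<subseteq> S" "K \<subseteq> g ` T" "g ` T \<noteq> {}" by auto
    then have "g ` T = K"
      using K[unfolded in_components_maximal] by simp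
    then have "h ` (g ` T) = h ` K" by simp
    then show "T = h ` K" by (simp add: image_image hg(4))
  qed
qed

text \<open>
  This carries both the number of curves and their being circles over to an isotopic link.
\<close>

lemma components_image_homeomorphism:
  assumes h: "homeomorphism UNIV UNIV h g"
  shows "components (h ` S) = (`) h ` components S"
proof
  have hg: "g (h x) = x" "h (g y) = y" for x y
    using h by (auto simp: homeomorphism_def)
  show "(`) h ` components S \<subseteq> components (h ` S)"
    using components_homeomorphic_image[OF h] by blast
  show "components (h ` S) \<subseteq> (`) h ` components S"
  proof
    fix K assume "K \<in> components (h ` S)"
    from components_homeomorphic_image[OF homeomorphism_symD[OF h] this]
    have "g ` K \<in> components S" by (simp add: image_image hg)
    moreover have "K = h ` (g ` K)" by (simp add: image_image hg)
    ultimately show "K \<in> (`) h ` components S" by blast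
  qed
qed

lemma closed_curves_homeomorphic_image:
  assumes h: "homeomorphism UNIV UNIV h g" and D: "closed_curves D"
  shows "closed_curves (h ` D)"
proof -
  have "h ` K homeomorphic sphere (0::real^2) 1" if "K \<in> components D" for K
  proof -
    have "homeomorphism K (h ` K) h g"
      using h by (rule homeomorphism_of_subsets) auto
    then have "h ` K homeomorphic K"
      using homeomorphic_def homeomorphic_sym by blast
    then show ?thesis
      using D that unfolding closed_curves_def by (blast intro: homeomorphic_trans)
  qed
  then show ?thesis
    using D unfolding closed_curves_def components_image_homeomorphism[OF h] by auto
qed

text \<open>
  Seen from \<open>a\<close>, the segment enters the convex set \<open>N\<close> at most once and then stays inside up to
  its end \<open>c\<close>. The point \<open>d\<close> is the last one outside.
\<close>

lemma closed_segment_diff_convex_end: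
  fixes a c :: "'a::euclidean_space"
  assumes N: "convex N" "open N" and c: "c \<in> N"
  shows "closed_segment a c - N = {} \<or> (\<exists>d. closed_segment a c - N = closed_segment a d)"
proof (cases "closed_segment a c - N = {}")
  case False
  define f where "f u = a + u *\<^sub>R (c - a)" for u :: real
  have fa: "(1 - u) *\<^sub>R a + u *\<^sub>R c = f u" for u
    by (simp add: f_def algebra_simps)
  have seg: "closed_segment a c = f ` {0..1}"
    by (auto simp: closed_segment_def fa)
  define K where "K = {u \<in> {0..1}. f u \<notin> N}"
  have "continuous_on UNIV f" unfolding f_def by (intro continuous_intros)
  then have "closed (f -` (- N))"
    using N by (intro continuous_closed_vimage) (auto simp: continuous_on_eq_continuous_at)
  moreover have "K = {0..1} \<inter> f -` (- N)" by (auto simp: K_def)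
  ultimately have "compact K" by (simp add: compact_Int_closed)
  moreover have "K \<noteq> {}" using False unfolding seg K_def by auto
  ultimately obtain m where m: "m \<in> K" "\<And>u. u \<in> K \<Longrightarrow> u \<le> m"
    using compact_attains_sup by metis
  have down: "u \<in> K" if u: "0 \<le> u" "u \<le> m" for u
  proof (rule ccontr)
    assume "u \<notin> K"
    have "m \<le> 1" "u \<noteq> m" using m(1) \<open>u \<notin> K\<close> by (auto simp: K_def)
    moreover have "f u \<in> N" using \<open>u \<notin> K\<close> u \<open>m \<le> 1\<close> by (auto simp: K_def)
    ultimately have fu: "f u \<in> N" "u < m" "m \<le> 1" using u by auto
    \<comment> \<open>the point at \<open>m\<close> lies between those at \<open>u\<close> and \<open>1\<close>, which are in the convex set\<close>
    define \<theta> where "\<theta> = (m - u) / (1 - u)"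
    have "\<theta> * (1 - u) = m - u" using fu by (simp add: \<theta>_def)
    then have \<theta>: "0 \<le> \<theta>" "\<theta> \<le> 1" "(1 - \<theta>) * u + \<theta> = m"
      using fu by (auto simp: \<theta>_def divide_simps) (simp add: algebra_simps)
    have "(1 - \<theta>) *\<^sub>R f u + \<theta> *\<^sub>R f 1 = a + ((1 - \<theta>) * u + \<theta>) *\<^sub>R (c - a)"
      by (simp add: f_def algebra_simps)
    also have "\<dots> = f m" by (simp add: \<theta>(3) f_def)
    finally have "f m = (1 - \<theta>) *\<^sub>R f u + \<theta> *\<^sub>R f 1" by simp
    then have "f m \<in> N"
      using convexD_alt[OF N(1) fu(1) _ \<theta>(1,2), of "f 1"] c by (simp add: f_def)
    with m show False by (simp add: K_def)
  qed
  have nonneg: "0 \<le> u" if "u \<in> K" for u using that by (simp add: K_def)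
  have "u \<in> K \<longleftrightarrow> u \<in> {0..m}" for u
    using down[of u] m(2)[of u] nonneg[of u] unfolding atLeastAtMost_iff by argo
  then have "K = {0..m}" by blast
  have "0 \<le> m" by (rule nonneg[OF m(1)])
  have "closed_segment a c - N = f ` K" unfolding seg K_def by auto
  also have "\<dots> = closed_segment a (f m)"
  proof -
    have "f ` {0..m} = (\<lambda>v. f (m * v)) ` {0..1}"
    proof
      show "f ` {0..m} \<subseteq> (\<lambda>v. f (m * v)) ` {0..1}"
      proof clarify
        fix u assume "u \<in> {0..m}"
        then show "f u \<in> (\<lambda>v. f (m * v)) ` {0..1}"
          by (cases "m = 0") (auto intro!: image_eqI[of _ _ "u / m"] simp: field_simps)
      qed
      show "(\<lambda>v. f (m * v)) ` {0..1} \<subseteq> f ` {0..m}"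
        using \<open>0 \<le> m\<close> by (auto intro!: imageI simp: mult_left_le)
    qed
    also have "\<dots> = closed_segment a (f m)"
    proof -
      have "(1 - u) *\<^sub>R a + u *\<^sub>R f m = f (m * u)" for u
        by (simp add: f_def algebra_simps)
      then show ?thesis by (auto simp: closed_segment_def)
    qed
    finally show ?thesis unfolding \<open>K = {0..m}\<close> .
  qed
  finally show ?thesis by blast
qed auto

definition polygonal_set :: "'a::euclidean_space set \<Rightarrow> bool" where
  "polygonal_set P \<longleftrightarrow> (\<exists>S. finite S \<and> P = (\<Union>(a, b)\<in>S. closed_segment a b))"

lemma polygonal_set_closed_segment [simp]: "polygonal_set (closed_segment a b)"
  unfolding polygonal_set_def by (rule exI[of _ "{(a, b)}"]) auto

lemma polygonal_set_empty [simp]: "polygonal_set {}"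
  unfolding polygonal_set_def by (rule exI[of _ "{}"]) auto

lemma polygonal_set_Un:
  assumes "polygonal_set P" "polygonal_set Q" shows "polygonal_set (P \<union> Q)"
proof -
  obtain S T where "finite S" "P = (\<Union>(a, b)\<in>S. closed_segment a b)"
    "finite T" "Q = (\<Union>(a, b)\<in>T. closed_segment a b)"
    using assms unfolding polygonal_set_def by blast
  then show ?thesis
    unfolding polygonal_set_def by (intro exI[of _ "S \<union> T"]) auto
qed

lemma polygonal_set_UN:
  "finite I \<Longrightarrow> (\<And>i. i \<in> I \<Longrightarrow> polygonal_set (P i)) \<Longrightarrow> polygonal_set (\<Union>i\<in>I. P i)"
  by (induction I rule: finite_induct) (auto intro: polygonal_set_Un)

text \<open>
  Needed for the link with the support of a bump removed: what is left has to be a finite union of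
  segments again.
\<close>

lemma polygonal_set_diff_convex:
  assumes P: "polygonal_set P" and N: "convex N" "open N"
  shows "polygonal_set (P - N)"
proof -
  obtain S where S: "finite S" "P = (\<Union>(a, b)\<in>S. closed_segment a b)"
    using P unfolding polygonal_set_def by blast
  have "polygonal_set (closed_segment a b - N)" for a b
  proof (cases "closed_segment a b \<inter> N = {}")
    case True
    then have "closed_segment a b - N = closed_segment a b" by blast
    then show ?thesis by simp
  next
    case False
    then obtain c where c: "c \<in> closed_segment a b" "c \<in> N" by blast
    have end_poly: "polygonal_set (closed_segment d c - N)" for d
      using closed_segment_diff_convex_end[OF N c(2), of d] by (metis polygonal_set_closed_segment polygonal_set_empty)
    have "closed_segment a b - N = (closed_segment a c - N) \<union> (closed_segment b c - N)"
      using Un_closed_segment[OF c(1)] closed_segment_commute[of b c] by blast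
    then show ?thesis using end_poly polygonal_set_Un by metis
  qed
  moreover have "P - N = (\<Union>i\<in>S. closed_segment (fst i) (snd i) - N)"
    using S(2) by auto
  ultimately show ?thesis
    using polygonal_set_UN[OF S(1), of "\<lambda>i. closed_segment (fst i) (snd i) - N"] by metis
qed

text \<open>
  A ball around \<open>x\<close> that misses the segments not through \<open>x\<close> meets the set in a star with centre \<open>x\<close>.
\<close>

lemma polygonal_set_locally_connected:
  assumes P: "polygonal_set P" and x: "x \<in> P" and e: "e > 0"
  obtains r where "r > 0" "r \<le> e" "connected (P \<inter> ball x r)"
proof -
  obtain S where S: "finite S" "P = (\<Union>(a, b)\<in>S. closed_segment a b)"
    using P unfolding polygonal_set_def by blast
  define S' where "S' = {i \<in> S. x \<notin> closed_segment (fst i) (snd i)}"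
  define C where "C = (\<Union>i\<in>S'. closed_segment (fst i) (snd i))"
  have "closed C" "x \<notin> C"
    using S(1) by (auto simp: C_def S'_def)
  then obtain d where d: "d > 0" "ball x d \<subseteq> - C"
    by (meson Compl_iff open_Compl openE)
  define r where "r = min d e"
  have "P \<inter> ball x r = (\<Union>i\<in>S - S'. closed_segment (fst i) (snd i) \<inter> ball x r)"
  proof (intro equalityI subsetI)
    fix y assume y: "y \<in> P \<inter> ball x r"
    then obtain i where i: "i \<in> S" "y \<in> closed_segment (fst i) (snd i)"
      unfolding S(2) by auto
    have "y \<in> ball x d" using y by (simp add: r_def)
    then have "y \<notin> C" using d(2) by blast
    then have "i \<notin> S'" using i by (auto simp: C_def)
    then show "y \<in> (\<Union>i\<in>S - S'. closed_segment (fst i) (snd i) \<inter> ball x r)"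
      using i y by blast
  next
    fix y assume "y \<in> (\<Union>i\<in>S - S'. closed_segment (fst i) (snd i) \<inter> ball x r)"
    then obtain i where "i \<in> S" "y \<in> closed_segment (fst i) (snd i)" "y \<in> ball x r" by blast
    then show "y \<in> P \<inter> ball x r" unfolding S(2) by (cases i) auto
  qed
  moreover have "connected (\<Union>i\<in>S - S'. closed_segment (fst i) (snd i) \<inter> ball x r)"
  proof (rule connected_Union)
    show "connected T" if "T \<in> (\<lambda>i. closed_segment (fst i) (snd i) \<inter> ball x r) ` (S - S')" for T
      using that by (auto intro!: convex_connected convex_Int)
    have "x \<in> \<Inter> ((\<lambda>i. closed_segment (fst i) (snd i) \<inter> ball x r) ` (S - S'))"
      using d e by (auto simp: S'_def r_def)
    then show "\<Inter> ((\<lambda>i. closed_segment (fst i) (snd i) \<inter> ball x r) ` (S - S')) \<noteq> {}" by blast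
  qed
  ultimately show ?thesis
    using that[of r] d e by (auto simp: r_def)
qed

lemma polygonal_set_compact: "polygonal_set P \<Longrightarrow> compact P"
  unfolding polygonal_set_def by auto

lemma polygonal_link_alt: "polygonal_link L \<longleftrightarrow> closed_curves L \<and> polygonal_set L"
  by (simp add: polygonal_link_def polygonal_set_def)

section \<open>Arcs and crossings of a diagram\<close>

lemma arcs_disjoint:
  assumes "A \<in> arcs D" "B \<in> arcs D" "y \<in> A" "y \<in> B" shows "A = B"
  using assms components_eq[of A _ B] unfolding arcs_def by blast

lemma arc_through:
  assumes "y \<in> D" "y \<notin> snd ` crossings D"
  obtains A where "A \<in> arcs D" "y \<in> A"
  using assms Union_components[of "D - snd ` crossings D"] unfolding arcs_def by blast

lemma arcsD:
  assumes "A \<in> arcs D"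
  shows "A \<noteq> {}" "A \<subseteq> D" "A \<inter> snd ` crossings D = {}" "connected A"
  using in_components_nonempty[OF assms[unfolded arcs_def]]
    in_components_subset[OF assms[unfolded arcs_def]]
    in_components_connected[OF assms[unfolded arcs_def]] by blast+

lemma connected_subset_arc:
  assumes "A \<in> arcs D" "connected K" "K \<subseteq> D - snd ` crossings D" "y \<in> A" "y \<in> K"
  shows "K \<subseteq> A"
  using components_maximal[OF assms(1)[unfolded arcs_def] assms(2,3)] assms(4,5) by blast

text \<open>
  Any open neighbourhood may be used instead of a ball. In particular straightness does not depend
  on the metric, so it can be checked in affine coordinates.
\<close>

lemma straight_atI:
  assumes "open S" "x \<in> S" "v \<noteq> 0" "D \<inter> S = range (\<lambda>t. x + t *\<^sub>R v) \<inter> S"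
  shows "straight_at D x"
proof -
  obtain r where "r > 0" "ball x r \<subseteq> S" using assms openE by blast
  with assms show ?thesis
    unfolding straight_at_def by (intro exI[of _ v] exI[of _ r]) blast
qed

lemma finite_punctured_ball:
  fixes x :: "'a::metric_space"
  assumes "finite U"
  obtains e where "e > 0" "ball x e \<inter> U \<subseteq> {x}"
proof -
  have "open (- (U - {x}))" "x \<in> - (U - {x})"
    using assms by (auto intro!: open_Compl finite_imp_closed simp del: Compl_Diff_eq)
  then obtain e where "e > 0" "ball x e \<subseteq> - (U - {x})" using openE by blast
  then show ?thesis using that by blast
qed

lemma link_diagramD:
  assumes "link_diagram D"
  shows "polygonal_set D" "compact D" "closed_curves D" "finite (crossings D)"
    "\<And>x y z. x \<in> D \<Longrightarrow> y \<in> D \<Longrightarrow> z \<in> D \<Longrightarrow> plane_proj x = plane_proj y \<Longrightarrow>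
      plane_proj y = plane_proj z \<Longrightarrow> x = y \<or> y = z \<or> x = z"
    "\<And>x u. (x, u) \<in> crossings D \<Longrightarrow> straight_at D x"
    "\<And>x u. (x, u) \<in> crossings D \<Longrightarrow> straight_at D u"
  using assms polygonal_set_compact unfolding link_diagram_def polygonal_link_alt by blast+

lemma crossingsD:
  assumes "(x, u) \<in> crossings D"
  shows "x \<in> D" "u \<in> D" "plane_proj x = plane_proj u" "u $ 3 < x $ 3" "x \<noteq> u"
  using assms by (auto simp: crossings_def)

lemma over_unique:
  assumes "link_diagram D" "(x, u) \<in> crossings D" "(y, u) \<in> crossings D"
  shows "x = y"
proof -
  have "x = u \<or> u = y \<or> x = y"
    by (rule link_diagramD(5)[OF assms(1)]) (simp_all add: crossingsD[OF assms(2)] crossingsD[OF assms(3)])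
  then show ?thesis
    using crossingsD(5)[OF assms(2)] crossingsD(5)[OF assms(3)] by metis
qed

lemma over_not_under:
  assumes "link_diagram D" "(x, u) \<in> crossings D"
  shows "x \<notin> snd ` crossings D"
proof
  assume "x \<in> snd ` crossings D"
  then obtain y where y: "(y, x) \<in> crossings D" by auto
  have "y = x \<or> x = u \<or> y = u"
    by (rule link_diagramD(5)[OF assms(1)]) (simp_all add: crossingsD[OF assms(2)] crossingsD[OF y])
  then show False
    using crossingsD(4,5)[OF assms(2)] crossingsD(4,5)[OF y] by auto
qed

lemma plane_proj_eq_imp_eq:
  assumes "plane_proj x = plane_proj y" "x $ 3 = y $ 3" shows "x = y"
  using assms by (simp add: plane_proj_def vec_eq_iff forall_3)

lemma under_arcs_sym: "under_arcs u A B \<Longrightarrow> under_arcs u B A"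
  unfolding under_arcs_def
proof (elim exE conjE)
  fix v :: r3
  assume v: "v \<noteq> 0" "\<forall>\<^sub>F t in at_right 0. u + t *\<^sub>R v \<in> A \<and> u - t *\<^sub>R v \<in> B"
  show "\<exists>v. v \<noteq> 0 \<and> (\<forall>\<^sub>F t in at_right 0. u + t *\<^sub>R v \<in> B \<and> u - t *\<^sub>R v \<in> A)"
    by (rule exI[of _ "- v"]) (use v in \<open>auto elim: eventually_mono\<close>)
qed

lemma half_strand_connected:
  fixes u v :: "'a::real_normed_vector"
  shows "connected ((\<lambda>t. u + t *\<^sub>R v) ` {0<..<b::real})"
  by (intro connected_continuous_image continuous_intros) auto

text \<open>
  The link is straight at \<open>u\<close> and has only finitely many undercrossings, so the two half-lines at
  \<open>u\<close> initially lie in one arc each.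
\<close>

lemma under_arcs_exist:
  assumes D: "link_diagram D" and xu: "(x, u) \<in> crossings D"
  obtains A B W where "A \<in> arcs D" "B \<in> arcs D" "under_arcs u A B"
    "open W" "u \<in> W" "D \<inter> W \<subseteq> insert u (A \<union> B)"
proof -
  let ?U = "snd ` crossings D"
  obtain v r where v: "v \<noteq> 0" "r > 0" "D \<inter> ball u r = range (\<lambda>t. u + t *\<^sub>R v) \<inter> ball u r"
    using link_diagramD(7)[OF D xu] unfolding straight_at_def by blast
  obtain e where e: "e > 0" "ball u e \<inter> ?U \<subseteq> {u}"
    using finite_punctured_ball[of ?U u] link_diagramD(4)[OF D] by blast
  define b where "b = min r e / norm v"
  have b: "b > 0" using v e by (simp add: b_def)
  have half: "\<exists>A\<in>arcs D. (\<lambda>t. u + t *\<^sub>R w) ` {0<..<b} \<subseteq> A" if w: "w = v \<or> w = - v" for w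
  proof -
    let ?T = "(\<lambda>t. u + t *\<^sub>R w) ` {0<..<b}"
    have nw: "norm w = norm v" "w \<noteq> 0" using w v by auto
    have "?T \<subseteq> D - ?U"
    proof
      fix y assume "y \<in> ?T"
      then obtain t where t: "0 < t" "t < b" "y = u + t *\<^sub>R w" by auto
      have "norm (t *\<^sub>R w) < min r e"
        using t v by (simp add: b_def nw pos_less_divide_eq)
      then have y: "y \<in> ball u r" "y \<in> ball u e" by (auto simp: t dist_norm)
      have "y = u + (if w = v then t else - t) *\<^sub>R v" using w t by auto
      then have "y \<in> D" using v y by blast
      moreover have "y \<noteq> u" using t nw by simp
      ultimately show "y \<in> D - ?U" using e y by blast
    qed
    moreover have "?T \<noteq> {}" using b by auto
    ultimately obtain A where "A \<in> components (D - ?U)" "?T \<subseteq> A"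
      using exists_component_superset[of ?T "D - ?U"] half_strand_connected by blast
    then show ?thesis unfolding arcs_def by blast
  qed
  obtain A where A: "A \<in> arcs D" "(\<lambda>t. u + t *\<^sub>R v) ` {0<..<b} \<subseteq> A" using half by blast
  obtain B where B: "B \<in> arcs D" "(\<lambda>t. u + t *\<^sub>R (- v)) ` {0<..<b} \<subseteq> B" using half by blast
  have "\<forall>\<^sub>F t in at_right 0. u + t *\<^sub>R v \<in> A \<and> u - t *\<^sub>R v \<in> B"
  proof (rule eventually_mono[OF eventually_at_right_real[OF b]])
    fix t assume "t \<in> {0<..<b}"
    then have "u + t *\<^sub>R v \<in> A" "u + t *\<^sub>R (- v) \<in> B" using A B by blast+
    then show "u + t *\<^sub>R v \<in> A \<and> u - t *\<^sub>R v \<in> B" by simp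
  qed
  then have "under_arcs u A B" using v unfolding under_arcs_def by blast
  moreover have "D \<inter> ball u (min r e) \<subseteq> insert u (A \<union> B)"
  proof
    fix y assume y: "y \<in> D \<inter> ball u (min r e)"
    then have "y \<in> D \<inter> ball u r" by simp
    then have "y \<in> range (\<lambda>t. u + t *\<^sub>R v)" using v(3) by blast
    then obtain t where t: "y = u + t *\<^sub>R v" by blast
    then have "\<bar>t\<bar> < b" using y v by (auto simp: b_def dist_norm pos_less_divide_eq)
    then consider "t = 0" | "t \<in> {0<..<b}" | "- t \<in> {0<..<b}" by fastforce
    then show "y \<in> insert u (A \<union> B)"
    proof cases
      case 3
      then have "u + (- t) *\<^sub>R (- v) \<in> B" using B by blast
      then show ?thesis using t by simp
    qed (use t A in auto)
  qed
  ultimately show ?thesis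
    using that[of A B "ball u (min r e)"] A B v e by auto
qed

section \<open>Non-split links have a crossing with two colors\<close>

text \<open>
  A Urysohn function on the plane that separates the two shadows tells how far to lift each point.
  It vanishes on the shadow of \<open>K\<close>, which therefore stays in its ball, and it lifts all of \<open>M\<close> by
  the same amount, chosen larger than the sum of the two radii.
\<close>

lemma split_linkI:
  assumes K: "compact K" "compact M" "K \<noteq> {}" "M \<noteq> {}"
    and disj: "plane_proj ` K \<inter> plane_proj ` M = {}"
  shows "split_link (K \<union> M)"
proof -
  have "closed (plane_proj ` K)" "closed (plane_proj ` M)"
    using K continuous_on_plane_proj by (auto intro: compact_imp_closed compact_continuous_image)
  then obtain f :: "real \<times> real \<Rightarrow> real" where f: "continuous_on UNIV f"
    "\<And>q. f q = 0 \<longleftrightarrow> q \<in> plane_proj ` K" "\<And>q. f q = 1 \<longleftrightarrow> q \<in> plane_proj ` M"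
    using Urysohn_strong[OF _ _ disj zero_neq_one] by metis
  obtain R where R: "R > 0" "K \<union> M \<subseteq> cball 0 R"
    using bounded_subset_ballD[of "K \<union> M" 0] K compact_imp_bounded ball_subset_cball
    by (metis bounded_Un subset_trans)
  \<comment> \<open>any shift by more than \<open>2 * R\<close> separates the balls\<close>
  define T where "T = 3 * R"
  define h where "h x = x + (T * f (plane_proj x)) *\<^sub>R axis 3 1" for x :: r3
  have "continuous_on UNIV (\<lambda>q. T * f q)" using f(1) by (intro continuous_intros)
  from lift_isotopy[OF this, of "K \<union> M"]
  have iso: "ambient_isotopic (K \<union> M) (h ` (K \<union> M))" by (simp add: h_def[abs_def])
  have hK: "h x = x" if "x \<in> K" for x
    using f(2)[of "plane_proj x"] that by (simp add: h_def)
  have hM: "h x = x + T *\<^sub>R axis 3 1" if "x \<in> M" for x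
    using f(3)[of "plane_proj x"] that by (simp add: h_def)
  have "h ` K \<subseteq> cball 0 R" using R hK by auto
  moreover have "h ` M \<subseteq> cball (T *\<^sub>R axis 3 1) R" using R hM by (auto simp: dist_norm)
  moreover have "cball 0 R \<inter> cball (T *\<^sub>R axis 3 1 :: r3) R = {}"
  proof -
    have "dist (0::r3) (T *\<^sub>R axis 3 1) > R + R"
      using R by (simp add: T_def norm_axis_1)
    then show ?thesis by (intro disjoint_cballI) auto
  qed
  ultimately have "cball 0 R \<inter> cball (T *\<^sub>R axis 3 1 :: r3) R = {} \<and>
      h ` (K \<union> M) \<subseteq> cball 0 R \<union> cball (T *\<^sub>R axis 3 1) R \<and>
      h ` (K \<union> M) \<inter> cball 0 R \<noteq> {} \<and> h ` (K \<union> M) \<inter> cball (T *\<^sub>R axis 3 1) R \<noteq> {}"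
    using K(3,4) by blast
  with iso show ?thesis unfolding split_link_def by metis
qed

lemma split_link_isotopic: "ambient_isotopic L D \<Longrightarrow> split_link D \<Longrightarrow> split_link L"
  unfolding split_link_def using ambient_isotopic_trans by blast

text \<open>
  Otherwise the coloring extends over the undercrossings to a locally constant function on the link
  that takes equal values at the two points of a crossing. Then the level sets show that the link is split.
\<close>

lemma bichromatic_crossing:
  assumes D: "link_diagram D" and nsplit: "\<not> split_link D" and c: "nontrivial_coloring p D c"
  obtains x u C A B where "(x, u) \<in> crossings D" "C \<in> arcs D" "A \<in> arcs D" "B \<in> arcs D" "x \<in> C"
    "under_arcs u A B" "c A \<noteq> c C"
proof (rule ccontr)
  assume "\<not> thesis"
  with that have mono: "c A = c C" if "(x, u) \<in> crossings D" "C \<in> arcs D" "A \<in> arcs D" "B \<in> arcs D"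
    "x \<in> C" "under_arcs u A B" for x u C A B
    using that by blast
  let ?U = "snd ` crossings D"
  \<comment> \<open>At an undercrossing the color of the upper strand is taken.\<close>
  define ov where "ov u = (SOME x. (x, u) \<in> crossings D)" for u
  have ov: "ov u = x" if "(x, u) \<in> crossings D" for x u
    unfolding ov_def using that over_unique[OF D] by (metis someI)
  define k where "k x = c (connected_component_set (D - ?U) (if x \<in> ?U then ov x else x))" for x
  have k_arc: "k y = c A" if "A \<in> arcs D" "y \<in> A" for A y
  proof -
    have "y \<in> D - ?U" using that in_components_subset unfolding arcs_def by blast
    moreover have "connected_component_set (D - ?U) y = A"
      using that unfolding arcs_def components_def using connected_component_eq by fastforce
    ultimately show ?thesis by (simp add: k_def)
  qed
  have ex_arc: "\<exists>A\<in>arcs D. y \<in> A" if "y \<in> D - ?U" for y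
    using that Union_components[of "D - ?U"] unfolding arcs_def by blast
  have k_cross: "k x = k u" if xu: "(x, u) \<in> crossings D" for x u
  proof -
    have "x \<notin> ?U" "u \<in> ?U" using over_not_under[OF D xu] xu by force+
    then show ?thesis by (simp add: k_def ov[OF xu])
  qed
  have loc: "\<exists>W. open W \<and> x \<in> W \<and> (\<forall>y\<in>D \<inter> W. k y = k x)" if x: "x \<in> D" for x
  proof (cases "x \<in> ?U")
    case False
    obtain e where e: "e > 0" "ball x e \<inter> ?U \<subseteq> {x}"
      using finite_punctured_ball[of ?U x] link_diagramD(4)[OF D] by blast
    obtain r where r: "r > 0" "r \<le> e" "connected (D \<inter> ball x r)"
      using polygonal_set_locally_connected[OF link_diagramD(1)[OF D] x e(1)] .
    have "ball x r \<subseteq> ball x e" using r by (simp add: subset_ball)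
    then have sub: "D \<inter> ball x r \<subseteq> D - ?U" using e False by blast
    obtain A where A: "A \<in> arcs D" "x \<in> A" using ex_arc x False by blast
    have "A \<inter> (D \<inter> ball x r) \<noteq> {}"
      using A(2) r(1) x centre_in_ball by blast
    then have "D \<inter> ball x r \<subseteq> A"
      using components_maximal[OF A(1)[unfolded arcs_def] r(3) sub] by simp
    then have "\<forall>y\<in>D \<inter> ball x r. k y = k x" using k_arc[OF A(1)] A(2) by (metis subsetD)
    then show ?thesis using r by (intro exI[of _ "ball x r"]) auto
  next
    case True
    then obtain z where z: "(z, x) \<in> crossings D" by auto
    obtain A B W where AB: "A \<in> arcs D" "B \<in> arcs D" "under_arcs x A B"
      "open W" "x \<in> W" "D \<inter> W \<subseteq> insert x (A \<union> B)"
      using under_arcs_exist[OF D z] .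
    obtain C where C: "C \<in> arcs D" "z \<in> C"
      using ex_arc crossingsD[OF z] over_not_under[OF D z] by blast
    have "c A = c C" "c B = c C"
      using mono[OF z C(1) AB(1,2) C(2) AB(3)] mono[OF z C(1) AB(2,1) C(2) under_arcs_sym[OF AB(3)]]
      by auto
    moreover have "k x = c C" using k_arc[OF C] k_cross[OF z] by simp
    ultimately have "k y = k x" if "y \<in> D" "y \<in> W" for y
      using AB(6) k_arc[OF AB(1), of y] k_arc[OF AB(2), of y] that by auto
    then show ?thesis using AB(4,5) by (metis IntD1 IntD2)
  qed
  have closed_part: "compact {y \<in> D. k y \<in> J}" for J
  proof -
    have op: "openin (top_of_set D) {y \<in> D. k y \<in> - J}"
      unfolding openin_euclidean_subtopology_iff
    proof (intro conjI ballI)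
      fix y assume y: "y \<in> {y \<in> D. k y \<in> - J}"
      then have yD: "y \<in> D" "k y \<in> - J" by auto
      obtain W where W: "open W" "y \<in> W" "\<forall>z\<in>D \<inter> W. k z = k y" using loc[OF yD(1)] by metis
      obtain e where e: "e > 0" "ball y e \<subseteq> W" using openE[OF W(1,2)] by metis
      have "z \<in> {y \<in> D. k y \<in> - J}" if z: "z \<in> D" "dist z y < e" for z
      proof -
        have "z \<in> W" using z e(2) by (auto simp: dist_commute)
        then have "k z = k y" using W(3) z(1) by (metis IntI)
        then show ?thesis using yD(2) z(1) by simp
      qed
      then show "\<exists>e>0. \<forall>z\<in>D. dist z y < e \<longrightarrow> z \<in> {y \<in> D. k y \<in> - J}"
        using e(1) by metis
    qed auto
    have "D - {y \<in> D. k y \<in> J} = {y \<in> D. k y \<in> - J}" by auto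
    then have "openin (top_of_set D) (D - {y \<in> D. k y \<in> J})" using op by metis
    then have "closedin (top_of_set D) {y \<in> D. k y \<in> J}"
      by (simp add: closedin_def Collect_restrict)
    then show ?thesis using closedin_compact[OF link_diagramD(2)[OF D]] by simp
  qed
  have "card (c ` arcs D) > 1" using c by (simp add: nontrivial_coloring_def)
  then obtain A B where AB: "A \<in> arcs D" "B \<in> arcs D" "c A \<noteq> c B"
  proof -
    assume big: "card (c ` arcs D) > 1"
    assume *: "\<And>A B. A \<in> arcs D \<Longrightarrow> B \<in> arcs D \<Longrightarrow> c A \<noteq> c B \<Longrightarrow> thesis"
    show thesis
    proof (rule ccontr)
      assume "\<not> thesis"
      then have "a = b" if "a \<in> c ` arcs D" "b \<in> c ` arcs D" for a b
        using that * by (metis imageE)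
      then have "card (c ` arcs D) \<le> 1"
        using card_le_Suc0_iff_eq[of "c ` arcs D"] big
        by (metis One_nat_def card.infinite zero_le_one)
      then show False using big by simp
    qed
  qed
  define K where "K = {y \<in> D. k y \<in> {c A}}"
  define M where "M = {y \<in> D. k y \<in> - {c A}}"
  have arc_pt: "\<exists>y\<in>D. y \<in> X" if "X \<in> arcs D" for X
    using in_components_nonempty[of X] in_components_subset[of X] that unfolding arcs_def by blast
  have "K \<noteq> {}" "M \<noteq> {}" using arc_pt[OF AB(1)] arc_pt[OF AB(2)] k_arc AB by (auto simp: K_def M_def)
  moreover have "compact K" "compact M" unfolding K_def M_def by (rule closed_part)+
  moreover have "plane_proj ` K \<inter> plane_proj ` M = {}"
  proof -
    have no: False if "x \<in> K" "y \<in> M" "plane_proj x = plane_proj y" for x y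
    proof -
      have xy: "x \<in> D" "y \<in> D" "k x \<noteq> k y" using that by (auto simp: K_def M_def)
      then have "x $ 3 \<noteq> y $ 3" using plane_proj_eq_imp_eq[OF that(3)] by auto
      then have "(x, y) \<in> crossings D \<or> (y, x) \<in> crossings D"
        using xy that(3) by (auto simp: crossings_def)
      then show False using k_cross xy(3) by metis
    qed
    show ?thesis
    proof (rule equals0I, elim IntE imageE)
      fix q x y assume "q = plane_proj x" "x \<in> K" "q = plane_proj y" "y \<in> M"
      then show False using no[of x y] by simp
    qed
  qed
  ultimately have "split_link (K \<union> M)" by (intro split_linkI)
  moreover have "K \<union> M = D" by (auto simp: K_def M_def)
  ultimately show False using nsplit by simp
qed

section \<open>Coordinates around a crossing\<close>

lemma plane_proj_simps [simp]:
  "plane_proj (a + b) = plane_proj a + plane_proj b"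
  "plane_proj (a - b) = plane_proj a - plane_proj b"
  "plane_proj (c *\<^sub>R a) = c *\<^sub>R plane_proj a"
  "plane_proj 0 = 0"
  by (simp_all add: plane_proj_def zero_prod_def)

lemma dist_self_add: "dist a (a + b) = norm (b :: 'a::real_normed_vector)"
  by (simp add: dist_norm)

lemma segment_in_ball:
  fixes x v :: "'a::real_normed_vector"
  assumes "norm v * b < r"
  shows "\<bar>t\<bar> \<le> b \<Longrightarrow> x + t *\<^sub>R v \<in> ball x r"
proof -
  assume "\<bar>t\<bar> \<le> b"
  then have "norm (t *\<^sub>R v) \<le> norm v * b" by (simp add: mult.commute[of _ "norm v"] mult_left_mono)
  then show ?thesis using assms by (simp add: dist_norm)
qed

text \<open>
  A linear relation between the shadows of the two strands would produce a whole interval of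
  crossings. This covers vertical strands and strands with parallel shadows at once.
\<close>

lemma transversal_crossing:
  assumes D: "link_diagram D" and xu: "(x, u) \<in> crossings D" and r: "r > 0"
    and v: "v \<noteq> 0" "D \<inter> ball x r = range (\<lambda>t. x + t *\<^sub>R v) \<inter> ball x r"
    and w: "w \<noteq> 0" "D \<inter> ball u r = range (\<lambda>t. u + t *\<^sub>R w) \<inter> ball u r"
    and dep: "a *\<^sub>R plane_proj v + b *\<^sub>R plane_proj w = 0"
  shows "a = 0 \<and> b = 0"
proof (rule ccontr)
  assume ab: "\<not> (a = 0 \<and> b = 0)"
  define P where "P t = (x + (t * a) *\<^sub>R v, u + (t * (- b)) *\<^sub>R w)" for t
  have "\<forall>\<^sub>F t in at_right (0::real). P t \<in> crossings D"
  proof -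
    have "((\<lambda>t. x + (t * a) *\<^sub>R v) \<longlongrightarrow> x + (0 * a) *\<^sub>R v) (at_right 0)"
      "((\<lambda>t. u + (t * (- b)) *\<^sub>R w) \<longlongrightarrow> u + (0 * (- b)) *\<^sub>R w) (at_right 0)"
      by (intro tendsto_intros)+
    then have lim: "((\<lambda>t. x + (t * a) *\<^sub>R v) \<longlongrightarrow> x) (at_right 0)"
      "((\<lambda>t. u + (t * (- b)) *\<^sub>R w) \<longlongrightarrow> u) (at_right 0)" by simp_all
    have "((\<lambda>t. (x + (t * a) *\<^sub>R v) $ 3 - (u + (t * (- b)) *\<^sub>R w) $ 3) \<longlongrightarrow> x $ 3 - u $ 3) (at_right 0)"
      by (intro tendsto_diff tendsto_vec_nth lim)
    moreover have "0 < x $ 3 - u $ 3" using crossingsD(4)[OF xu] by simp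
    ultimately have "\<forall>\<^sub>F t in at_right 0. 0 < (x + (t * a) *\<^sub>R v) $ 3 - (u + (t * (- b)) *\<^sub>R w) $ 3"
      by (rule order_tendstoD(1))
    moreover have "\<forall>\<^sub>F t in at_right 0. x + (t * a) *\<^sub>R v \<in> ball x r"
      by (rule topological_tendstoD[OF lim(1)]) (use r in simp_all)
    moreover have "\<forall>\<^sub>F t in at_right 0. u + (t * (- b)) *\<^sub>R w \<in> ball u r"
      by (rule topological_tendstoD[OF lim(2)]) (use r in simp_all)
    ultimately show ?thesis
    proof eventually_elim
      case (elim t)
      have "x + (t * a) *\<^sub>R v \<in> D" "u + (t * (- b)) *\<^sub>R w \<in> D"
        using elim v(2) w(2) by blast+
      moreover have "t *\<^sub>R (a *\<^sub>R plane_proj v + b *\<^sub>R plane_proj w) = 0" by (simp add: dep)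
      then have "plane_proj (x + (t * a) *\<^sub>R v) = plane_proj (u + (t * (- b)) *\<^sub>R w)"
        using crossingsD(3)[OF xu] by (simp add: algebra_simps add_eq_0_iff)
      ultimately show ?case using elim(1) by (simp add: crossings_def P_def)
    qed
  qed
  then obtain e where e: "e > 0" "\<And>t. 0 < t \<Longrightarrow> t < e \<Longrightarrow> P t \<in> crossings D"
    unfolding eventually_at_right_field by auto
  have "inj P"
    using ab v(1) w(1) by (auto simp: inj_on_def P_def)
  then have "inj_on P {0<..<e}" using inj_on_subset by blast
  moreover have "P ` {0<..<e} \<subseteq> crossings D" using e(2) by auto
  ultimately have "finite {0<..<e}"
    using link_diagramD(4)[OF D] by (metis finite_imageD finite_subset)
  then show False using e(1) by (simp add: infinite_Ioo)
qed

text \<open>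
  The numbers \<open>s\<close>, \<open>t\<close>, \<open>z\<close> are affine coordinates in which the crossing is standard: the upper strand is
  the line \<open>t = 0\<close>, \<open>z = 1\<close>, the lower strand is the line \<open>s = 0\<close>, \<open>z = 0\<close>, and the \<open>z\<close>-axis is vertical
  because \<open>x\<close> lies above \<open>u\<close>. Over the square of side eight there is nothing else of the link. The
  bound 4 leaves room for the finger.
\<close>

locale crossing_chart =
  fixes D :: "r3 set" and x u v w :: r3
  assumes D: "link_diagram D" and xu: "(x, u) \<in> crossings D"
    and indep: "a *\<^sub>R plane_proj v + b *\<^sub>R plane_proj w = 0 \<Longrightarrow> a = 0 \<and> b = 0"
    and strands: "\<bar>s\<bar> \<le> 4 \<Longrightarrow> \<bar>t\<bar> \<le> 4 \<Longrightarrow> u + s *\<^sub>R v + t *\<^sub>R w + z *\<^sub>R (x - u) \<in> D \<longleftrightarrow>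
      t = 0 \<and> z = 1 \<or> s = 0 \<and> z = 0"

text \<open>
  By compactness, the only points of the link whose shadows are close to the crossing are close to
  \<open>x\<close> or \<open>u\<close>, where the link is straight. Shrinking the direction vectors brings the
  square into that region. The vector \<open>w\<close> is chosen to point into the given arc \<open>A\<close>, which is the one
  that the finger will be pulled from.
\<close>

lemma crossing_chart_exists:
  assumes D: "link_diagram D" and xu: "(x, u) \<in> crossings D" and AB: "under_arcs u A B"
    and A: "A \<in> arcs D"
  obtains v w where "crossing_chart D x u v w" "\<forall>\<^sub>F t in at_right 0. u + t *\<^sub>R w \<in> A"
proof -
  obtain v0 r1 where v0: "v0 \<noteq> 0" "r1 > 0" "D \<inter> ball x r1 = range (\<lambda>t. x + t *\<^sub>R v0) \<inter> ball x r1"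
    using link_diagramD(6)[OF D xu] unfolding straight_at_def by blast
  obtain w0 r2 where w0: "w0 \<noteq> 0" "r2 > 0" "D \<inter> ball u r2 = range (\<lambda>t. u + t *\<^sub>R w0) \<inter> ball u r2"
    using link_diagramD(7)[OF D xu] unfolding straight_at_def by blast
  obtain d where d: "d \<noteq> 0" "\<forall>\<^sub>F t in at_right 0. u + t *\<^sub>R d \<in> A \<and> u - t *\<^sub>R d \<in> B"
    using AB unfolding under_arcs_def by blast
  have dA: "\<forall>\<^sub>F t in at_right 0. u + t *\<^sub>R d \<in> A"
    using d(2) by (rule eventually_mono) simp
  have AD: "A \<subseteq> D" using A in_components_subset unfolding arcs_def by blast
  obtain \<alpha> where \<alpha>: "d = \<alpha> *\<^sub>R w0" "\<alpha> \<noteq> 0"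
  proof -
    have "((\<lambda>t. u + t *\<^sub>R d) \<longlongrightarrow> u + 0 *\<^sub>R d) (at_right 0)" by (intro tendsto_intros)
    then have "((\<lambda>t. u + t *\<^sub>R d) \<longlongrightarrow> u) (at_right 0)" by simp
    then have "\<forall>\<^sub>F t in at_right 0. u + t *\<^sub>R d \<in> ball u r2"
      by (rule topological_tendstoD) (use w0(2) in simp_all)
    then have "\<forall>\<^sub>F t in at_right (0::real). u + t *\<^sub>R d \<in> ball u r2 \<and> u + t *\<^sub>R d \<in> A \<and> t > 0"
      using dA eventually_at_right_less by eventually_elim auto
    from eventually_happens[OF this]
    obtain t where t: "u + t *\<^sub>R d \<in> ball u r2" "u + t *\<^sub>R d \<in> A" "t > 0"
      by (elim disjE exE conjE) simp_all
    then have "u + t *\<^sub>R d \<in> D \<inter> ball u r2" using AD by blast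
    then obtain s where "u + t *\<^sub>R d = u + s *\<^sub>R w0" unfolding w0(3) by blast
    then have td: "t *\<^sub>R d = s *\<^sub>R w0" by simp
    have "d = inverse t *\<^sub>R (t *\<^sub>R d)" using t(3) by simp
    also have "\<dots> = (s / t) *\<^sub>R w0" unfolding td by (simp add: divide_inverse mult.commute)
    finally have "d = (s / t) *\<^sub>R w0" .
    then show ?thesis using that d(1) by auto
  qed
  have "range (\<lambda>t. u + t *\<^sub>R w0) = range (\<lambda>t. u + t *\<^sub>R d)"
  proof (intro equalityI subsetI)
    fix y assume "y \<in> range (\<lambda>t. u + t *\<^sub>R w0)"
    then obtain t where "y = u + (t / \<alpha>) *\<^sub>R d" using \<alpha> by auto
    then show "y \<in> range (\<lambda>t. u + t *\<^sub>R d)" by blast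
  next
    fix y assume "y \<in> range (\<lambda>t. u + t *\<^sub>R d)"
    then obtain t where "y = u + (t * \<alpha>) *\<^sub>R w0" using \<alpha> by auto
    then show "y \<in> range (\<lambda>t. u + t *\<^sub>R w0)" by blast
  qed
  then have w0d: "D \<inter> ball u r2 = range (\<lambda>t. u + t *\<^sub>R d) \<inter> ball u r2" using w0(3) by simp
  define r where "r = min r1 r2"
  have r: "r > 0" using v0 w0 by (simp add: r_def)
  have sub: "ball x r \<subseteq> ball x r1" "ball u r \<subseteq> ball u r2" by (auto simp: r_def)
  have sx: "D \<inter> ball x r = range (\<lambda>t. x + t *\<^sub>R v0) \<inter> ball x r"
    using v0(3) sub(1) by blast
  have su: "D \<inter> ball u r = range (\<lambda>t. u + t *\<^sub>R d) \<inter> ball u r"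
    using w0d sub(2) by blast
  have ind: "a = 0 \<and> b = 0" if "a *\<^sub>R plane_proj v0 + b *\<^sub>R plane_proj d = 0" for a b
    by (rule transversal_crossing[OF D xu r v0(1) sx d(1) su that])
  define K where "K = D - (ball x r \<union> ball u r)"
  have "compact K" unfolding K_def using link_diagramD(2)[OF D] by (intro compact_diff) auto
  then have "closed (plane_proj ` K)"
    by (intro compact_imp_closed compact_continuous_image continuous_on_plane_proj)
  moreover have "plane_proj u \<notin> plane_proj ` K"
  proof
    assume "plane_proj u \<in> plane_proj ` K"
    then obtain y where y: "y \<in> K" "plane_proj y = plane_proj u" by (metis imageE)
    then have "y = u \<or> u = x \<or> y = x"
      using crossingsD[OF xu] by (intro link_diagramD(5)[OF D]) (auto simp: K_def)
    then show False using y r crossingsD(5)[OF xu] by (auto simp: K_def)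
  qed
  ultimately obtain \<delta> where \<delta>: "\<delta> > 0" "ball (plane_proj u) \<delta> \<subseteq> - plane_proj ` K"
    by (meson ComplI open_Compl openE)
  define M where "M = norm v0 + norm d + norm (plane_proj v0) + norm (plane_proj d)"
  \<comment> \<open>The window has half-width 4, so 5 makes all strict inequalities hold.\<close>
  define \<epsilon> where "\<epsilon> = min r \<delta> / (5 * M)"
  have nv0: "norm v0 > 0" using v0(1) by simp
  have M: "M > 0" unfolding M_def by (intro add_pos_nonneg nv0) auto
  have \<epsilon>: "\<epsilon> > 0" using M r \<delta> by (simp add: \<epsilon>_def)
  have small: "4 * (\<epsilon> * n) < min r \<delta>" if "n \<le> M" for n
  proof -
    have "4 * (\<epsilon> * n) \<le> 4 * (\<epsilon> * M)" using \<epsilon> that by simp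
    also have "\<dots> = 4 / 5 * min r \<delta>" using M by (simp add: \<epsilon>_def)
    also have "\<dots> < min r \<delta>"
    proof -
      have "0 < min r \<delta>" using r \<delta>(1) by simp
      then show ?thesis by linarith
    qed
    finally show ?thesis .
  qed
  define v where "v = \<epsilon> *\<^sub>R v0"
  define w where "w = \<epsilon> *\<^sub>R d"
  have vball: "x + s *\<^sub>R v \<in> ball x r" if "\<bar>s\<bar> \<le> 4" for s
    using that small[of "norm v0"] \<epsilon> nv0
    by (intro segment_in_ball[of _ 4]) (auto simp: v_def M_def mult_ac)
  have wball: "u + s *\<^sub>R w \<in> ball u r" if "\<bar>s\<bar> \<le> 4" for s
    using that small[of "norm d"] \<epsilon> nv0
    by (intro segment_in_ball[of _ 4]) (auto simp: w_def M_def mult_ac)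
  have "crossing_chart D x u v w"
  proof
    show "link_diagram D" "(x, u) \<in> crossings D" by fact+
    show "a = 0 \<and> b = 0" if "a *\<^sub>R plane_proj v + b *\<^sub>R plane_proj w = 0" for a b
      using ind[of "a * \<epsilon>" "b * \<epsilon>"] that \<epsilon> by (simp add: v_def w_def)
    show "u + s *\<^sub>R v + t *\<^sub>R w + z *\<^sub>R (x - u) \<in> D \<longleftrightarrow> t = 0 \<and> z = 1 \<or> s = 0 \<and> z = 0"
      (is "?y \<in> D \<longleftrightarrow> ?R") if st: "\<bar>s\<bar> \<le> 4" "\<bar>t\<bar> \<le> 4" for s t z
    proof
      assume y: "?y \<in> D"
      have pxu: "plane_proj x = plane_proj u" by (rule crossingsD(3)[OF xu])
      have py: "plane_proj ?y = plane_proj u + (s *\<^sub>R plane_proj v + t *\<^sub>R plane_proj w)"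
        using pxu by (simp add: algebra_simps)
      have "norm (s *\<^sub>R plane_proj v + t *\<^sub>R plane_proj w)
          \<le> \<bar>s\<bar> * norm (plane_proj v) + \<bar>t\<bar> * norm (plane_proj w)"
        by (metis norm_scaleR norm_triangle_ineq)
      also have "\<dots> \<le> 4 * norm (plane_proj v) + 4 * norm (plane_proj w)"
        using st by (intro add_mono mult_right_mono) auto
      also have "\<dots> = 4 * (\<epsilon> * (norm (plane_proj v0) + norm (plane_proj d)))"
        using \<epsilon> by (simp add: v_def w_def algebra_simps)
      also have "\<dots> < \<delta>"
        using small[of "norm (plane_proj v0) + norm (plane_proj d)"] by (simp add: M_def)
      finally have "plane_proj ?y \<in> ball (plane_proj u) \<delta>"
        unfolding py mem_ball dist_self_add .
      then have "?y \<notin> K" using \<delta>(2) by (metis ComplD imageI subsetD)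
      then consider "?y \<in> D \<inter> ball x r" | "?y \<in> D \<inter> ball u r" using y by (auto simp: K_def)
      then show ?R
      proof cases
        case 1
        then obtain c where c: "?y = x + c *\<^sub>R v0" unfolding sx by blast
        have "plane_proj ?y = plane_proj u + c *\<^sub>R plane_proj v0" unfolding c using pxu by simp
        then have "(s * \<epsilon> - c) *\<^sub>R plane_proj v0 + (t * \<epsilon>) *\<^sub>R plane_proj d = 0"
          unfolding py by (simp add: v_def w_def algebra_simps)
        from ind[OF this] have t: "t = 0" and sc: "c = s * \<epsilon>" using \<epsilon> by auto
        have "(z - 1) *\<^sub>R (x - u) = 0" using c unfolding t sc by (simp add: v_def algebra_simps)
        then show ?thesis using t crossingsD(5)[OF xu] by simp
      next
        case 2
        then obtain c where c: "?y = u + c *\<^sub>R d" unfolding su by blast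
        have "plane_proj ?y = plane_proj u + c *\<^sub>R plane_proj d" unfolding c by simp
        then have "(s * \<epsilon>) *\<^sub>R plane_proj v0 + (t * \<epsilon> - c) *\<^sub>R plane_proj d = 0"
          unfolding py by (simp add: v_def w_def algebra_simps)
        from ind[OF this] have t: "s = 0" and sc: "c = t * \<epsilon>" using \<epsilon> by auto
        have "z *\<^sub>R (x - u) = 0" using c unfolding t sc by (simp add: w_def algebra_simps)
        then show ?thesis using t crossingsD(5)[OF xu] by simp
      qed
    next
      assume ?R
      then consider "?y = x + s *\<^sub>R v" | "?y = u + t *\<^sub>R w" by fastforce
      then show "?y \<in> D"
      proof cases
        case 1
        have "x + s *\<^sub>R v = x + (s * \<epsilon>) *\<^sub>R v0" by (simp add: v_def)
        then have "x + s *\<^sub>R v \<in> range (\<lambda>t. x + t *\<^sub>R v0)" by blast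
        then have "x + s *\<^sub>R v \<in> D \<inter> ball x r" unfolding sx using vball[OF st(1)] by blast
        then show ?thesis unfolding 1 by blast
      next
        case 2
        have "u + t *\<^sub>R w = u + (t * \<epsilon>) *\<^sub>R d" by (simp add: w_def)
        then have "u + t *\<^sub>R w \<in> range (\<lambda>t. u + t *\<^sub>R d)" by blast
        then have "u + t *\<^sub>R w \<in> D \<inter> ball u r" unfolding su using wball[OF st(2)] by blast
        then show ?thesis unfolding 2 by blast
      qed
    qed
  qed
  moreover have "\<forall>\<^sub>F t in at_right 0. u + t *\<^sub>R w \<in> A"
  proof -
    obtain b where b: "b > 0" "\<And>t. 0 < t \<Longrightarrow> t < b \<Longrightarrow> u + t *\<^sub>R d \<in> A"
      using dA unfolding eventually_at_right_field by auto
    have "u + t *\<^sub>R w \<in> A" if "0 < t" "t < b / \<epsilon>" for t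
      using b(2)[of "t * \<epsilon>"] that \<epsilon> by (simp add: w_def pos_less_divide_eq)
    then show ?thesis
      unfolding eventually_at_right_field using b(1) \<epsilon> by (intro exI[of _ "b / \<epsilon>"]) auto
  qed
  ultimately show ?thesis by (rule that)
qed

context crossing_chart
begin

definition chart :: "real \<Rightarrow> real \<Rightarrow> real \<Rightarrow> r3" where
  "chart s t z = u + s *\<^sub>R v + t *\<^sub>R w + z *\<^sub>R (x - u)"

text \<open>
  The linear part of \<open>chart\<close>, used to invert it.
\<close>

definition lin :: "r3 \<Rightarrow> r3" where
  "lin y = (y $ 1) *\<^sub>R v + (y $ 2) *\<^sub>R w + (y $ 3) *\<^sub>R (x - u)"

definition lin_inv :: "r3 \<Rightarrow> r3" where "lin_inv = inv_into UNIV lin"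

definition S :: "r3 \<Rightarrow> real" where "S p = lin_inv (p - u) $ 1"
definition T :: "r3 \<Rightarrow> real" where "T p = lin_inv (p - u) $ 2"
definition Z :: "r3 \<Rightarrow> real" where "Z p = lin_inv (p - u) $ 3"

lemma proj_x_u: "plane_proj x = plane_proj u"
  by (rule crossingsD(3)[OF xu])

lemma linear_lin: "linear lin"
  by (rule linearI) (simp_all add: lin_def algebra_simps)

lemma inj_lin: "inj lin"
  unfolding linear_injective_0[OF linear_lin]
proof (intro allI impI)
  fix y assume y: "lin y = 0"
  have "plane_proj (lin y) = (y $ 1) *\<^sub>R plane_proj v + (y $ 2) *\<^sub>R plane_proj w"
    by (simp add: lin_def proj_x_u)
  then have "y $ 1 = 0 \<and> y $ 2 = 0" by (intro indep) (simp add: y)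
  moreover from this have "y $ 3 = 0"
    using y crossingsD(5)[OF xu] by (simp add: lin_def)
  ultimately show "y = 0" by (simp add: vec_eq_iff forall_3)
qed

lemma lin_inv_lin [simp]: "lin_inv (lin y) = y" "lin (lin_inv y) = y"
proof -
  show "lin_inv (lin y) = y" by (simp add: lin_inv_def inj_lin)
  have "surj lin" by (rule linear_injective_imp_surjective[OF linear_lin inj_lin refl])
  then show "lin (lin_inv y) = y" by (simp add: lin_inv_def surj_f_inv_f)
qed

lemma linear_lin_inv: "linear (lin_inv)"
proof (rule linearI)
  show "lin_inv (a + b) = lin_inv a + lin_inv b" for a b
    using lin_inv_lin(1)[of "lin_inv a + lin_inv b"] by (simp add: linear_add[OF linear_lin])
  show "lin_inv (c *\<^sub>R a) = c *\<^sub>R lin_inv a" for c a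
    using lin_inv_lin(1)[of "c *\<^sub>R lin_inv a"] by (simp add: linear_scale[OF linear_lin])
qed

lemma chart_lin: "chart s t z = u + lin (vector [s, t, z])"
  by (simp add: chart_def lin_def vector_3)

lemma coords_chart [simp]: "S (chart s t z) = s" "T (chart s t z) = t" "Z (chart s t z) = z"
  by (simp_all add: S_def T_def Z_def chart_lin vector_3)

lemma chart_coords [simp]: "chart (S p) (T p) (Z p) = p"
proof -
  have "lin (lin_inv (p - u)) = p - u" by simp
  then show ?thesis by (simp add: chart_def lin_def S_def T_def Z_def algebra_simps)
qed

lemma eq_chart_iff: "p = chart s t z \<longleftrightarrow> S p = s \<and> T p = t \<and> Z p = z"
  by (metis chart_coords coords_chart)

lemma coords_eqI: "S p = S q \<Longrightarrow> T p = T q \<Longrightarrow> Z p = Z q \<Longrightarrow> p = q"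
  by (metis chart_coords)

lemma chart_eq_iff: "chart s t z = chart s' t' z' \<longleftrightarrow> s = s' \<and> t = t' \<and> z = z'"
  by (metis coords_chart)

lemma continuous_coords: "continuous_on X S" "continuous_on X T" "continuous_on X Z"
proof -
  have "continuous_on UNIV (lin_inv)"
    by (intro linear_continuous_on linear_conv_bounded_linear[THEN iffD1] linear_lin_inv)
  then have "continuous_on X (\<lambda>p. lin_inv (p - u))"
    by (rule continuous_on_compose2) (auto intro!: continuous_intros)
  then show "continuous_on X S" "continuous_on X T" "continuous_on X Z"
    unfolding S_def T_def Z_def by (auto intro!: continuous_on_component)
qed

lemma continuous_chart:
  assumes "continuous_on X f1" "continuous_on X f2" "continuous_on X f3"
  shows "continuous_on X (\<lambda>y. chart (f1 y) (f2 y) (f3 y))"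
  unfolding chart_def by (intro continuous_intros assms)

lemma coords_affine:
  assumes "a + b = 1"
  shows "S (a *\<^sub>R p + b *\<^sub>R q) = a * S p + b * S q"
    "T (a *\<^sub>R p + b *\<^sub>R q) = a * T p + b * T q"
    "Z (a *\<^sub>R p + b *\<^sub>R q) = a * Z p + b * Z q"
proof -
  have "a *\<^sub>R p + b *\<^sub>R q = a *\<^sub>R chart (S p) (T p) (Z p) + b *\<^sub>R chart (S q) (T q) (Z q)" by simp
  also have "\<dots> = (a + b) *\<^sub>R u + (a * S p + b * S q) *\<^sub>R v + (a * T p + b * T q) *\<^sub>R w +
      (a * Z p + b * Z q) *\<^sub>R (x - u)"
    unfolding chart_def by (simp add: algebra_simps)
  also have "\<dots> = chart (a * S p + b * S q) (a * T p + b * T q) (a * Z p + b * Z q)"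
    by (simp add: chart_def assms)
  finally show "S (a *\<^sub>R p + b *\<^sub>R q) = a * S p + b * S q"
    "T (a *\<^sub>R p + b *\<^sub>R q) = a * T p + b * T q"
    "Z (a *\<^sub>R p + b *\<^sub>R q) = a * Z p + b * Z q" by simp_all
qed

lemma chart_affine:
  assumes "a + b = 1"
  shows "a *\<^sub>R chart s t z + b *\<^sub>R chart s' t' z' = chart (a * s + b * s') (a * t + b * t') (a * z + b * z')"
  by (rule coords_eqI) (simp_all add: coords_affine[OF assms])

lemma chart_001: "chart 0 0 1 = x" and chart_000: "chart 0 0 0 = u"
  by (simp_all add: chart_def)

lemma coords_x_u [simp]: "S x = 0" "T x = 0" "Z x = 1" "S u = 0" "T u = 0" "Z u = 0"
  using coords_chart[of 0 0 1] coords_chart[of 0 0 0] unfolding chart_001 chart_000 by simp_all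

lemma plane_proj_chart: "plane_proj (chart s t z) = plane_proj u + s *\<^sub>R plane_proj v + t *\<^sub>R plane_proj w"
  by (simp add: chart_def proj_x_u)

lemma plane_proj_eq_iff: "plane_proj p = plane_proj q \<longleftrightarrow> S p = S q \<and> T p = T q"
proof
  assume "plane_proj p = plane_proj q"
  then have "plane_proj (chart (S p) (T p) (Z p)) = plane_proj (chart (S q) (T q) (Z q))" by simp
  then have "(S p - S q) *\<^sub>R plane_proj v + (T p - T q) *\<^sub>R plane_proj w = 0"
    unfolding plane_proj_chart by (simp add: algebra_simps)
  then show "S p = S q \<and> T p = T q" using indep by fastforce
next
  assume "S p = S q \<and> T p = T q"
  then have "plane_proj (chart (S p) (T p) (Z p)) = plane_proj (chart (S q) (T q) (Z q))"
    unfolding plane_proj_chart by simp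
  then show "plane_proj p = plane_proj q" unfolding chart_coords .
qed

text \<open>
  Together with \<open>plane_proj_eq_iff\<close> this reduces everything about crossings to the coordinates
  \<open>S\<close>, \<open>T\<close>, \<open>Z\<close>.
\<close>

lemma height_less_iff:
  assumes "plane_proj p = plane_proj q"
  shows "p $ 3 > q $ 3 \<longleftrightarrow> Z p > Z q"
proof -
  have "p $ 3 - q $ 3 = chart (S p) (T p) (Z p) $ 3 - chart (S q) (T q) (Z q) $ 3" by simp
  also have "\<dots> = (Z p - Z q) * (x $ 3 - u $ 3)"
    using assms[unfolded plane_proj_eq_iff] by (simp add: chart_def algebra_simps)
  finally have eq: "p $ 3 - q $ 3 = (Z p - Z q) * (x $ 3 - u $ 3)" .
  have "p $ 3 > q $ 3 \<longleftrightarrow> 0 < p $ 3 - q $ 3" by simp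
  also have "\<dots> \<longleftrightarrow> Z p > Z q"
    unfolding eq using crossingsD(4)[OF xu] by (simp add: zero_less_mult_iff)
  finally show ?thesis .
qed

lemma crossings_coords:
  "crossings X = {(a, b). a \<in> X \<and> b \<in> X \<and> S a = S b \<and> T a = T b \<and> Z a > Z b}"
  unfolding crossings_def using height_less_iff plane_proj_eq_iff by auto

definition in_window :: "r3 \<Rightarrow> bool" where
  "in_window p \<longleftrightarrow> \<bar>S p\<bar> \<le> 4 \<and> \<bar>T p\<bar> \<le> 4"

lemma in_window_cong: "S p = S q \<Longrightarrow> T p = T q \<Longrightarrow> in_window p \<longleftrightarrow> in_window q"
  by (simp add: in_window_def)

lemma D_in_window:
  assumes "in_window p"
  shows "p \<in> D \<longleftrightarrow> T p = 0 \<and> Z p = 1 \<or> S p = 0 \<and> Z p = 0"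
  using strands[of "S p" "T p" "Z p"] assms chart_coords[of p] by (simp add: in_window_def chart_def)

section \<open>Pulling a finger of the lower strand over the upper strand\<close>

text \<open>
  Coordinates that turn the support of the finger move into the unit ball. The first axis of the
  ball is the piece \<open>1/4 < t < 3/4\<close> of the lower strand, and the bump goes along the second axis, whose
  direction in the chart is \<open>(1, -1, 8)\<close>: across the upper strand and steeply upwards. Both
  \<open>T p + Z p / 8\<close> and \<open>S p - Z p / 8\<close> are constant in this direction. The first of them equals \<open>1/8\<close> on the
  upper strand and lies between \<open>1/4\<close> and \<open>3/4\<close> on the support; this is why the slope 8 suffices to
  keep the upper strand out of the way.
\<close>

definition ball_coords :: "r3 \<Rightarrow> r3" where
  "ball_coords p = vector [4 * (T p + Z p / 8 - 1 / 2), Z p / 16, S p - Z p / 8]"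

definition of_ball :: "r3 \<Rightarrow> r3" where
  "of_ball y = chart (2 * y $ 2 + y $ 3) (1 / 2 + y $ 1 / 4 - 2 * y $ 2) (16 * y $ 2)"

definition supp :: "r3 set" where "supp = {p. norm (ball_coords p) < 1}"
definition csupp :: "r3 set" where "csupp = {p. norm (ball_coords p) \<le> 1}"

definition push :: "r3 \<Rightarrow> r3" where "push p = of_ball (ball_coords p + bump (axis 2 1) (ball_coords p))"

text \<open>
  For \<open>1/4 < t < 3/4\<close>, the point \<open>t\<close> of the lower strand is moved by \<open>tent t\<close> times the vector \<open>(1, -1, 8)\<close> of the chart.
\<close>

definition tent :: "real \<Rightarrow> real" where "tent t = 1 - 4 * \<bar>t - 1 / 2\<bar>"

definition D' :: "r3 set" where "D' = push ` D"

lemma ball_coords_nth: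
  "ball_coords p $ 1 = 4 * (T p + Z p / 8 - 1 / 2)"
  "ball_coords p $ 2 = Z p / 16"
  "ball_coords p $ 3 = S p - Z p / 8"
  by (simp_all add: ball_coords_def vector_3)

lemma of_ball_coords: "of_ball (ball_coords p) = p"
proof -
  have "of_ball (ball_coords p) = chart (S p) (T p) (Z p)"
    unfolding of_ball_def ball_coords_nth chart_eq_iff by (simp add: field_simps)
  then show ?thesis by simp
qed

lemma ball_coords_of_ball: "ball_coords (of_ball y) = y"
  by (simp add: of_ball_def ball_coords_nth vec_eq_iff forall_3)

lemma homeo_ball: "homeomorphism UNIV UNIV of_ball ball_coords"
proof (rule homeomorphism_UNIV_I)
  show "continuous_on UNIV of_ball" unfolding of_ball_def by (intro continuous_chart continuous_intros) simp_all
  have comp: "continuous_on UNIV (\<lambda>p. ball_coords p $ i)" for i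
  proof -
    have "continuous_on UNIV (\<lambda>p. ball_coords p $ 1)" "continuous_on UNIV (\<lambda>p. ball_coords p $ 2)"
      "continuous_on UNIV (\<lambda>p. ball_coords p $ 3)"
      unfolding ball_coords_nth divide_inverse
      by (intro continuous_on_mult continuous_on_add continuous_on_diff continuous_on_const
          continuous_coords)+
    then show ?thesis using exhaust_3[of i] by auto
  qed
  then have "continuous_on UNIV (\<lambda>p. \<chi> i. ball_coords p $ i)" by (intro continuous_on_vec_lambda)
  then show "continuous_on UNIV ball_coords" by simp
qed (simp_all add: of_ball_coords ball_coords_of_ball)

lemma continuous_ball_coords: "continuous_on X ball_coords"
  using homeo_ball continuous_on_subset by (auto simp: homeomorphism_def)

lemma push_isotopic: "ambient_isotopic D D'"
  unfolding D'_def push_def by (rule bump_isotopy(1)[OF homeo_ball]) simp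

lemma push_homeo: "\<exists>g. homeomorphism UNIV UNIV push g"
  unfolding push_def by (rule bump_isotopy(2)[OF homeo_ball]) simp

lemma inj_push: "inj push"
  using push_homeo unfolding homeomorphism_def by (metis UNIV_I injI)

lemma push_off: "p \<notin> supp \<Longrightarrow> push p = p"
  by (simp add: push_def supp_def bump_def of_ball_coords max_def)

lemma open_supp: "open supp" and closed_csupp: "closed csupp"
proof -
  have "continuous_on UNIV (\<lambda>p. norm (ball_coords p))" by (intro continuous_intros continuous_ball_coords)
  then show "open supp" "closed csupp"
    unfolding supp_def csupp_def by (auto intro!: open_Collect_less closed_Collect_le continuous_intros)
qed

lemma supp_csupp: "supp \<subseteq> csupp"
  by (auto simp: supp_def csupp_def)

lemma convex_supp: "convex supp"
proof (rule convexI)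
  fix p q :: r3 and a b :: real
  assume pq: "p \<in> supp" "q \<in> supp" and ab: "0 \<le> a" "0 \<le> b" "a + b = 1"
  have b: "b = 1 - a" using ab by simp
  have "ball_coords (a *\<^sub>R p + b *\<^sub>R q) = a *\<^sub>R ball_coords p + b *\<^sub>R ball_coords q"
    by (simp add: vec_eq_iff forall_3 ball_coords_nth coords_affine[OF ab(3)]) (simp add: b field_simps)
  moreover have "a *\<^sub>R ball_coords p + b *\<^sub>R ball_coords q \<in> ball 0 1"
    using pq ab by (intro convexD[OF convex_ball]) (auto simp: supp_def)
  ultimately show "a *\<^sub>R p + b *\<^sub>R q \<in> supp" by (simp add: supp_def)
qed

text \<open>
  The last two bounds put the shadow of the support inside the window where the link is known.
\<close>

lemma csupp_bounds:
  assumes "p \<in> csupp"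
  shows "\<bar>T p + Z p / 8 - 1 / 2\<bar> \<le> 1 / 4" "\<bar>Z p\<bar> \<le> 16" "\<bar>S p - Z p / 8\<bar> \<le> 1"
    "\<bar>S p\<bar> < 4" "\<bar>T p\<bar> < 4"
proof -
  have "\<bar>ball_coords p $ i\<bar> \<le> 1" for i
    using component_le_norm_cart[of "ball_coords p" i] assms by (simp add: csupp_def)
  from this[of 1] this[of 2] this[of 3]
  show "\<bar>T p + Z p / 8 - 1 / 2\<bar> \<le> 1 / 4" "\<bar>Z p\<bar> \<le> 16" "\<bar>S p - Z p / 8\<bar> \<le> 1"
    "\<bar>S p\<bar> < 4" "\<bar>T p\<bar> < 4"
    unfolding ball_coords_nth abs_le_iff abs_less_iff by simp_all
qed

lemma supp_bounds:
  assumes "p \<in> supp"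
  shows "\<bar>T p + Z p / 8 - 1 / 2\<bar> < 1 / 4"
proof -
  have "\<bar>ball_coords p $ 1\<bar> < 1"
    using component_le_norm_cart[of "ball_coords p" 1] assms by (simp add: supp_def)
  then show ?thesis unfolding ball_coords_nth abs_mult by simp
qed

lemma csupp_in_window: "p \<in> csupp \<Longrightarrow> in_window p"
  using csupp_bounds(4,5)[of p] by (simp add: in_window_def)

lemma over_not_csupp: "chart s 0 1 \<notin> csupp"
  using csupp_bounds(1)[of "chart s 0 1"] by auto

lemma D_csupp: "p \<in> D \<Longrightarrow> p \<in> csupp \<Longrightarrow> S p = 0 \<and> Z p = 0"
  using D_in_window[OF csupp_in_window, of p] csupp_bounds(1)[of p] by auto

lemma norm_ball_coords_under: "norm (ball_coords (chart 0 t 0)) = 4 * \<bar>t - 1 / 2\<bar>"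
  by (simp add: norm_vec_def L2_set_def sum_3 ball_coords_nth abs_if)

text \<open>
  The move affects nothing but the chosen piece of the lower strand.
\<close>

lemma D_supp: "D \<inter> supp = (\<lambda>t. chart 0 t 0) ` {1/4<..<3/4}"
proof (intro equalityI subsetI)
  fix p assume p: "p \<in> D \<inter> supp"
  then have "S p = 0" "Z p = 0" using D_csupp supp_csupp by auto
  moreover have "1 / 4 < T p" "T p < 3 / 4"
    using supp_bounds[of p] p \<open>Z p = 0\<close> unfolding abs_less_iff by simp_all
  moreover have "p = chart 0 (T p) 0" using calculation by (simp add: eq_chart_iff)
  ultimately show "p \<in> (\<lambda>t. chart 0 t 0) ` {1/4<..<3/4}"
    by (intro image_eqI[of _ _ "T p"]) simp_all
next
  fix p assume "p \<in> (\<lambda>t. chart 0 t 0) ` {1/4<..<3/4}"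
  then obtain t where t: "p = chart 0 t 0" "1/4 < t" "t < 3/4" by auto
  have "p \<in> supp" unfolding supp_def using t by (simp add: norm_ball_coords_under abs_if)
  moreover have "in_window p" using t by (simp add: in_window_def)
  then have "p \<in> D" by (simp add: D_in_window t)
  ultimately show "p \<in> D \<inter> supp" by simp
qed

definition finger :: "r3 set" where
  "finger = (\<lambda>t. chart (tent t) (t - tent t) (8 * tent t)) ` {1/4<..<3/4}"

lemma push_under:
  assumes "1/4 < t" "t < 3/4"
  shows "push (chart 0 t 0) = chart (tent t) (t - tent t) (8 * tent t)"
proof -
  have nB: "norm (ball_coords (chart 0 t 0)) < 1" unfolding norm_ball_coords_under using assms by (simp add: abs_if)
  have "ball_coords (chart 0 t 0) + bump (axis 2 1) (ball_coords (chart 0 t 0)) = vector [4 * (t - 1/2), tent t / 2, 0]"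
    using nB by (simp add: vec_eq_iff forall_3 ball_coords_nth bump_def
        norm_ball_coords_under tent_def axis_def vector_3)
  then show ?thesis by (simp add: push_def of_ball_def vector_3 chart_eq_iff field_simps)
qed

lemma D'_eq: "D' = (D - supp) \<union> finger"
proof -
  have "D' = push ` (D - supp) \<union> push ` (D \<inter> supp)" unfolding D'_def by blast
  also have "push ` (D - supp) = (\<lambda>p. p) ` (D - supp)" by (rule image_cong) (auto simp: push_off)
  also have "push ` (D \<inter> supp) = finger"
    unfolding D_supp finger_def image_image by (rule image_cong) (auto simp: push_under)
  finally show ?thesis by simp
qed

lemma finger_supp: "finger \<subseteq> supp"
proof
  fix p assume "p \<in> finger"
  then obtain t where t: "p = chart (tent t) (t - tent t) (8 * tent t)" "1/4 < t" "t < 3/4"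
    by (auto simp: finger_def)
  have "norm (ball_coords p) \<le> \<bar>4 * (t - 1/2)\<bar> + \<bar>tent t / 2\<bar>"
    using norm_le_l1_cart[of "ball_coords p"] by (simp add: sum_3 ball_coords_nth t)
  also have "\<dots> < 1" using t by (simp add: tent_def abs_if field_simps split: if_splits)
  finally show "p \<in> supp" by (simp add: supp_def)
qed

lemma D'_off: "p \<notin> supp \<Longrightarrow> p \<in> D' \<longleftrightarrow> p \<in> D"
  using finger_supp by (auto simp: D'_eq)

lemma D'_supp: "D' \<inter> supp = finger"
  using finger_supp by (auto simp: D'_eq)

lemma D'_outside_in_window: "\<not> in_window p \<Longrightarrow> p \<in> D' \<longleftrightarrow> p \<in> D"
  using D'_off supp_csupp csupp_in_window by blast

lemma D'_in_window:
  assumes "in_window p" "p \<in> D'"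
  obtains (over) "T p = 0" "Z p = 1"
  | (under) "S p = 0" "Z p = 0"
  | (finger) t where "1/4 < t" "t < 3/4" "p = chart (tent t) (t - tent t) (8 * tent t)"
      "S p = tent t" "T p = t - tent t" "Z p = 8 * tent t" "tent t > 0"
proof (cases "p \<in> supp")
  case True
  then have "p \<in> finger" using D'_supp assms by blast
  then obtain t where t: "1/4 < t" "t < 3/4" "p = chart (tent t) (t - tent t) (8 * tent t)"
    by (auto simp: finger_def)
  then have "tent t > 0" by (simp add: tent_def abs_if split: if_splits)
  with t show ?thesis by (intro finger[of t]) simp_all
next
  case False
  then have "p \<in> D" using D'_off assms by blast
  then show ?thesis using D_in_window[OF assms(1)] over under by blast
qed

lemma finger_in_D': "1/4 < t \<Longrightarrow> t < 3/4 \<Longrightarrow> chart (tent t) (t - tent t) (8 * tent t) \<in> D'"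
  by (auto simp: D'_eq finger_def)

lemma over_in_D: "\<bar>s\<bar> \<le> 4 \<Longrightarrow> chart s 0 1 \<in> D"
  by (simp add: D_in_window in_window_def)

lemma over_in_D': "\<bar>s\<bar> \<le> 4 \<Longrightarrow> chart s 0 1 \<in> D'"
  using over_in_D over_not_csupp supp_csupp D'_off by blast

text \<open>
  The shadow of the finger meets the shadow of the upper strand where \<open>t = tent t\<close>, that is for
  \<open>t = 1/3\<close> on the way out and for \<open>t = 3/5\<close> on the way back. There the finger runs above
  (\<open>Y1\<close>, \<open>Y2\<close>), and the upper strand becomes the lower one (\<open>X1\<close>, \<open>X2\<close>).
\<close>

definition X1 :: r3 where "X1 = chart (1/3) 0 1"
definition X2 :: r3 where "X2 = chart (3/5) 0 1"
definition Y1 :: r3 where "Y1 = chart (1/3) 0 (8/3)"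
definition Y2 :: r3 where "Y2 = chart (3/5) 0 (24/5)"

lemma Y_tent: "Y1 = chart (tent (1/3)) (1/3 - tent (1/3)) (8 * tent (1/3))"
  "Y2 = chart (tent (3/5)) (3/5 - tent (3/5)) (8 * tent (3/5))"
  by (simp_all add: Y1_def Y2_def tent_def)

lemma tent_fixed: "t = tent t \<Longrightarrow> t = 1/3 \<or> t = 3/5"
  by (simp add: tent_def abs_if split: if_splits)

lemma tent_fixed_values: "tent (1/3) = 1/3" "tent (3/5) = 3/5"
  by (simp_all add: tent_def)

lemma crossing_in_window:
  assumes "(a, b) \<in> crossings D" "in_window a"
  shows "(a, b) = (x, u)"
proof -
  have ab: "a \<in> D" "b \<in> D" "S a = S b" "T a = T b" "Z a > Z b"
    using assms unfolding crossings_coords by auto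
  have "in_window b" using assms(2) in_window_cong ab(3,4) by blast
  then have "S a = 0 \<and> T a = 0 \<and> Z a = 1" "S b = 0 \<and> T b = 0 \<and> Z b = 0"
    using ab D_in_window[OF assms(2)] D_in_window[of b] by auto
  then show ?thesis
    using coords_eqI[of a x] coords_eqI[of b u] by simp
qed

text \<open>
  Shadows outside the window are those of the old diagram. Inside it, the finger casts an injective
  shadow (its points are told apart by \<open>S + T\<close>) that misses the lower strand, as \<open>S\<close> is positive on it.
\<close>

lemma crossings_D': "crossings D' = crossings D \<union> {(Y1, X1), (Y2, X2)}"
proof (intro equalityI subsetI)
  fix c assume "c \<in> crossings D'"
  then obtain a b where c: "c = (a, b)" and ab: "a \<in> D'" "b \<in> D'" "S a = S b" "T a = T b" "Z a > Z b"
    unfolding crossings_coords by auto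
  show "c \<in> crossings D \<union> {(Y1, X1), (Y2, X2)}"
  proof (cases "in_window a")
    case False
    then have "\<not> in_window b" using in_window_cong ab(3,4) by blast
    with False have "a \<in> D" "b \<in> D" using ab D'_outside_in_window by auto
    then show ?thesis using ab by (simp add: c crossings_coords)
  next
    case True
    then have winb: "in_window b" using in_window_cong ab(3,4) by blast
    show ?thesis
      using winb ab(2)
    proof (cases rule: D'_in_window)
      case b: over
      show ?thesis using True ab(1)
      proof (cases rule: D'_in_window)
        case (finger t)
        then have "t = tent t" using ab b by simp
        then have "t = 1/3 \<or> t = 3/5" by (rule tent_fixed)
        moreover have "b = chart (tent t) 0 1" using b ab finger by (simp add: eq_chart_iff)
        ultimately have "(a, b) = (Y1, X1) \<or> (a, b) = (Y2, X2)"
        proof (elim disjE)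
          assume t: "t = 1/3"
          have "a = Y1" using finger(3) unfolding t Y_tent(1) .
          moreover have "b = X1"
            using \<open>b = chart (tent t) 0 1\<close> unfolding t X1_def tent_fixed_values .
          ultimately show ?thesis by simp
        next
          assume t: "t = 3/5"
          have "a = Y2" using finger(3) unfolding t Y_tent(2) .
          moreover have "b = X2"
            using \<open>b = chart (tent t) 0 1\<close> unfolding t X2_def tent_fixed_values .
          ultimately show ?thesis by simp
        qed
        then show ?thesis by (auto simp: c)
      qed (use b ab in auto)
    next
      case b: under
      show ?thesis using True ab(1)
      proof (cases rule: D'_in_window)
        case over
        then have "(a, b) = (x, u)" using b ab using coords_eqI[of a x] coords_eqI[of b u] by simp
        then show ?thesis using xu by (simp add: c)
      qed (use b ab in auto)
    next
      case b: (finger t)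
      show ?thesis using True ab(1)
      proof (cases rule: D'_in_window)
        case over
        then have "t = tent t" using ab b by simp
        then have "t = 1/3 \<or> t = 3/5" by (rule tent_fixed)
        then show ?thesis using ab b over by (auto simp: tent_def)
      next
        case under
        then show ?thesis using ab b by auto
      next
        case (finger t')
        then have "tent t = tent t'" using ab b by simp
        then show ?thesis using ab b finger by simp
      qed
    qed
  qed
next
  fix c assume "c \<in> crossings D \<union> {(Y1, X1), (Y2, X2)}"
  then consider "c \<in> crossings D" "\<not> in_window (fst c)" | "c = (x, u)" | "c = (Y1, X1)" | "c = (Y2, X2)"
    using crossing_in_window by (metis UnE emptyE insertE prod.collapse)
  then show "c \<in> crossings D'"
  proof cases
    case 1
    obtain a b where c: "c = (a, b)" by fastforce
    have ab: "a \<in> D" "b \<in> D" "S a = S b" "T a = T b" "Z a > Z b"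
      using 1(1) unfolding crossings_coords c by auto
    have "\<not> in_window a" "\<not> in_window b" using 1(2) c in_window_cong[OF ab(3,4)] by auto
    then show ?thesis using ab D'_outside_in_window by (simp add: c crossings_coords)
  next
    case 2
    have "u \<notin> supp" using supp_bounds[of u] by auto
    then have "u \<in> D'" using D'_off crossingsD(2)[OF xu] by blast
    moreover have "x \<in> D'" using over_in_D'[of 0] by (simp add: chart_001)
    ultimately show ?thesis by (simp add: 2 crossings_coords)
  next
    case 3
    have "Y1 \<in> D'" unfolding Y_tent by (rule finger_in_D') simp_all
    moreover have "X1 \<in> D'" unfolding X1_def by (rule over_in_D') simp
    ultimately show ?thesis by (simp add: 3 crossings_coords) (simp add: X1_def Y1_def)
  next
    case 4
    have "Y2 \<in> D'" unfolding Y_tent by (rule finger_in_D') simp_all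
    moreover have "X2 \<in> D'" unfolding X2_def by (rule over_in_D') simp
    ultimately show ?thesis by (simp add: 4 crossings_coords) (simp add: X2_def Y2_def)
  qed
qed

section \<open>The pulled link is in regular position\<close>

lemma closed_segment_chart:
  "closed_segment (chart s t z) (chart s' t' z') =
    (\<lambda>a. chart ((1 - a) * s + a * s') ((1 - a) * t + a * t') ((1 - a) * z + a * z')) ` {0..1}"
proof -
  have "(1 - a) *\<^sub>R chart s t z + a *\<^sub>R chart s' t' z'
      = chart ((1 - a) * s + a * s') ((1 - a) * t + a * t') ((1 - a) * z + a * z')" for a
    by (rule chart_affine) simp
  then show ?thesis by (auto simp: closed_segment_def)
qed

text \<open>
  The closure of the finger consists of two sides of a triangle whose third side is the removed
  piece of the lower strand. The apex belongs to the middle \<open>t = 1/2\<close> of this piece.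
\<close>

lemma D'_segments:
  "D' = (D - supp) \<union> closed_segment (chart 0 (1/4) 0) (chart 1 (-1/2) 8) \<union>
    closed_segment (chart 1 (-1/2) 8) (chart 0 (3/4) 0)" (is "_ = _ \<union> ?PR \<union> ?RQ")
proof -
  have ends: "chart 0 t 0 \<in> D - supp" if "t = 1/4 \<or> t = 3/4" for t
    using that D_in_window[of "chart 0 t 0"] by (auto simp: in_window_def supp_def norm_ball_coords_under)
  have "finger \<subseteq> ?PR \<union> ?RQ"
  proof
    fix p assume "p \<in> finger"
    then obtain t where t: "p = chart (tent t) (t - tent t) (8 * tent t)" "1/4 < t" "t < 3/4"
      by (auto simp: finger_def)
    show "p \<in> ?PR \<union> ?RQ"
    proof (cases "t \<le> 1/2")
      case True
      then have "p \<in> ?PR" unfolding closed_segment_chart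
        using t by (intro image_eqI[of _ _ "tent t"]) (auto simp: chart_eq_iff tent_def abs_if field_simps)
      then show ?thesis by simp
    next
      case False
      then have "p \<in> ?RQ" unfolding closed_segment_chart
        using t by (intro image_eqI[of _ _ "1 - tent t"]) (auto simp: chart_eq_iff tent_def abs_if field_simps)
      then show ?thesis by simp
    qed
  qed
  moreover have "?PR \<subseteq> (D - supp) \<union> finger"
  proof
    fix p assume "p \<in> ?PR"
    then obtain a where a01: "a \<in> {0..1}"
      and p: "p = chart ((1 - a) * 0 + a * 1) ((1 - a) * (1/4) + a * (-1/2)) ((1 - a) * 0 + a * 8)"
      unfolding closed_segment_chart by (elim imageE)
    have a: "0 \<le> a" "a \<le> 1" "p = chart a (1/4 - 3/4 * a) (8 * a)"
      using a01 unfolding p chart_eq_iff by (simp_all add: field_simps)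
    show "p \<in> (D - supp) \<union> finger"
    proof (cases "a = 0")
      case True
      then show ?thesis using a ends[of "1/4"] by simp
    next
      case False
      then have "p \<in> finger" unfolding finger_def
        using a by (intro image_eqI[of _ _ "(1 + a) / 4"]) (auto simp: chart_eq_iff tent_def abs_if field_simps)
      then show ?thesis by simp
    qed
  qed
  moreover have "?RQ \<subseteq> (D - supp) \<union> finger"
  proof
    fix p assume "p \<in> ?RQ"
    then obtain a where a01: "a \<in> {0..1}"
      and p: "p = chart ((1 - a) * 1 + a * 0) ((1 - a) * (-1/2) + a * (3/4)) ((1 - a) * 8 + a * 0)"
      unfolding closed_segment_chart by (elim imageE)
    have a: "0 \<le> a" "a \<le> 1" "p = chart (1 - a) (5/4 * a - 1/2) (8 * (1 - a))"
      using a01 unfolding p chart_eq_iff by (simp_all add: field_simps)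
    show "p \<in> (D - supp) \<union> finger"
    proof (cases "a = 1")
      case True
      then show ?thesis using a ends[of "3/4"] by simp
    next
      case False
      then have "p \<in> finger" unfolding finger_def
        using a by (intro image_eqI[of _ _ "1/2 + a / 4"]) (auto simp: chart_eq_iff tent_def abs_if field_simps)
      then show ?thesis by simp
    qed
  qed
  ultimately show ?thesis unfolding D'_eq by blast
qed

lemma polygonal_D': "polygonal_set D'"
  unfolding D'_segments
  by (intro polygonal_set_Un polygonal_set_diff_convex polygonal_set_closed_segment
      link_diagramD(1)[OF D] convex_supp open_supp)

lemma closed_curves_D': "closed_curves D'"
  using push_homeo closed_curves_homeomorphic_image link_diagramD(3)[OF D] unfolding D'_def by blast

text \<open>
  An open set in which the new link is just the upper strand, which is where \<open>X1\<close> and \<open>X2\<close> lie.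
\<close>

definition over_box :: "r3 set" where
  "over_box = {p. \<bar>S p\<bar> < 4 \<and> \<bar>T p\<bar> < 4 \<and> 1/2 < Z p \<and> Z p < 2} - csupp"

lemma open_box:
  "open {p. a < S p \<and> S p < b \<and> \<bar>T p\<bar> < 4 \<and> 1/2 < Z p \<and> Z p < 2}"
  by (intro open_Collect_conj open_Collect_less continuous_coords continuous_intros)

lemma open_over_box: "open over_box"
proof -
  have "over_box = {p. - 4 < S p \<and> S p < 4 \<and> \<bar>T p\<bar> < 4 \<and> 1/2 < Z p \<and> Z p < 2} - csupp"
    unfolding over_box_def by (auto simp: abs_less_iff)
  then show ?thesis using open_box closed_csupp by (simp add: open_Diff)
qed

lemma over_in_over_box: "chart s 0 1 \<in> over_box \<longleftrightarrow> \<bar>s\<bar> < 4"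
  using over_not_csupp by (simp add: over_box_def)

lemma D'_over_box:
  assumes "p \<in> D'" "p \<in> over_box" shows "p = chart (S p) 0 1" "\<bar>S p\<bar> < 4"
proof -
  have w: "in_window p" using assms(2) by (simp add: over_box_def in_window_def)
  have "p \<notin> supp" using assms(2) supp_csupp by (auto simp: over_box_def)
  then have "p \<in> D" using assms(1) D'_off by blast
  then have "T p = 0 \<and> Z p = 1" using D_in_window[OF w] assms(2) by (auto simp: over_box_def)
  then show "p = chart (S p) 0 1" by (simp add: eq_chart_iff)
  show "\<bar>S p\<bar> < 4" using assms(2) by (simp add: over_box_def)
qed

lemma chart_add: "chart s t z + c *\<^sub>R (a *\<^sub>R v + b *\<^sub>R w + d *\<^sub>R (x - u)) = chart (s + c * a) (t + c * b) (z + c * d)"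
  by (simp add: chart_def algebra_simps)

lemma chart_add_v: "chart s t z + c *\<^sub>R v = chart (s + c) t z"
  by (simp add: chart_def algebra_simps)

lemma v_nonzero: "v \<noteq> 0"
  using indep[of 1 0] by auto

lemma straight_over:
  assumes "\<bar>s\<bar> < 4" shows "straight_at D' (chart s 0 1)"
proof (rule straight_atI[OF open_over_box _ v_nonzero])
  show "chart s 0 1 \<in> over_box" using assms by (simp add: over_in_over_box)
  show "D' \<inter> over_box = range (\<lambda>t. chart s 0 1 + t *\<^sub>R v) \<inter> over_box"
  proof (intro equalityI subsetI)
    fix p assume p: "p \<in> D' \<inter> over_box"
    then have "p = chart s 0 1 + (S p - s) *\<^sub>R v" using D'_over_box(1)[of p] by (simp add: chart_add_v)
    then show "p \<in> range (\<lambda>t. chart s 0 1 + t *\<^sub>R v) \<inter> over_box" using p by blast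
  next
    fix p assume p: "p \<in> range (\<lambda>t. chart s 0 1 + t *\<^sub>R v) \<inter> over_box"
    then obtain t where t: "p = chart (s + t) 0 1" by (auto simp: chart_add_v)
    then have "\<bar>s + t\<bar> < 4" using p over_in_over_box by simp
    then show "p \<in> D' \<inter> over_box" using p t over_in_D' by simp
  qed
qed

lemma finger_direction_nonzero:
  assumes "a \<noteq> 0" shows "a *\<^sub>R v + b *\<^sub>R w + d *\<^sub>R (x - u) \<noteq> 0"
proof
  assume "a *\<^sub>R v + b *\<^sub>R w + d *\<^sub>R (x - u) = 0"
  then have "u + (a *\<^sub>R v + b *\<^sub>R w + d *\<^sub>R (x - u)) = u" by simp
  then have "chart a b d = chart 0 0 0" unfolding chart_000 by (simp add: chart_def add.assoc)
  then show False using assms by (simp add: chart_eq_iff)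
qed

lemma straight_Y1: "straight_at D' Y1"
proof -
  \<comment> \<open>The side of the triangle with \<open>t < 1/2\<close>, where \<open>tent\<close> has slope 4.\<close>
  let ?d = "4 *\<^sub>R v + (-3) *\<^sub>R w + 32 *\<^sub>R (x - u)"
  let ?O = "supp \<inter> {p. T p + Z p / 8 < 1/2}"
  have "open {p. T p + Z p / 8 < 1/2}"
    by (intro open_Collect_less continuous_intros continuous_coords) simp_all
  then have op: "open ?O" using open_supp by blast
  have line: "Y1 + c *\<^sub>R ?d = chart (4 * c + 1/3) (-3 * c) (32 * c + 8/3)" for c
    unfolding Y1_def chart_add by (simp add: chart_eq_iff)
  have "Y1 \<in> supp" using finger_supp by (auto simp: Y_tent finger_def)
  then have Y1: "Y1 \<in> ?O" by (simp add: Y1_def)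
  have "D' \<inter> ?O = range (\<lambda>c. Y1 + c *\<^sub>R ?d) \<inter> ?O"
  proof (intro equalityI subsetI)
    fix p assume p: "p \<in> D' \<inter> ?O"
    then have "p \<in> finger" using D'_supp by blast
    then obtain t where t: "p = chart (tent t) (t - tent t) (8 * tent t)" by (auto simp: finger_def)
    then have "t < 1/2" using p by simp
    then have "p = Y1 + (t - 1/3) *\<^sub>R ?d" unfolding line t by (simp add: chart_eq_iff tent_def abs_if)
    then show "p \<in> range (\<lambda>c. Y1 + c *\<^sub>R ?d) \<inter> ?O" using p by blast
  next
    fix p assume p: "p \<in> range (\<lambda>c. Y1 + c *\<^sub>R ?d) \<inter> ?O"
    then obtain c where c: "p = chart (4 * c + 1/3) (-3 * c) (32 * c + 8/3)" unfolding line by auto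
    have e: "T p + Z p / 8 = c + 1/3" by (simp add: c add_divide_distrib)
    have "T p + Z p / 8 < 1/2" "\<bar>T p + Z p / 8 - 1/2\<bar> < 1/4" using p supp_bounds[of p] by auto
    then have b: "c + 1/3 < 1/2" "1/4 < c + 1/3" unfolding e abs_less_iff by linarith+
    then have "p \<in> finger" unfolding finger_def
      by (intro image_eqI[of _ _ "c + 1/3"]) (auto simp: c chart_eq_iff tent_def abs_if)
    then show "p \<in> D' \<inter> ?O" using p D'_eq by blast
  qed
  then show ?thesis
    by (rule straight_atI[OF op Y1 finger_direction_nonzero, rotated]) simp
qed

lemma straight_Y2: "straight_at D' Y2"
proof -
  \<comment> \<open>The side of the triangle with \<open>t > 1/2\<close>, where \<open>tent\<close> has slope \<open>-4\<close>.\<close>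
  let ?d = "(-4) *\<^sub>R v + 5 *\<^sub>R w + (-32) *\<^sub>R (x - u)"
  let ?O = "supp \<inter> {p. 1/2 < T p + Z p / 8}"
  have "open {p. 1/2 < T p + Z p / 8}"
    by (intro open_Collect_less continuous_intros continuous_coords) simp_all
  then have op: "open ?O" using open_supp by blast
  have line: "Y2 + c *\<^sub>R ?d = chart (3/5 - 4 * c) (5 * c) (24/5 - 32 * c)" for c
    unfolding Y2_def chart_add by (simp add: chart_eq_iff)
  have "Y2 \<in> supp" using finger_supp by (auto simp: Y_tent finger_def)
  then have Y2: "Y2 \<in> ?O" by (simp add: Y2_def)
  have "D' \<inter> ?O = range (\<lambda>c. Y2 + c *\<^sub>R ?d) \<inter> ?O"
  proof (intro equalityI subsetI)
    fix p assume p: "p \<in> D' \<inter> ?O"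
    then have "p \<in> finger" using D'_supp by blast
    then obtain t where t: "p = chart (tent t) (t - tent t) (8 * tent t)" by (auto simp: finger_def)
    then have "1/2 < t" using p by simp
    then have "p = Y2 + (t - 3/5) *\<^sub>R ?d" unfolding line t by (simp add: chart_eq_iff tent_def abs_if)
    then show "p \<in> range (\<lambda>c. Y2 + c *\<^sub>R ?d) \<inter> ?O" using p by blast
  next
    fix p assume p: "p \<in> range (\<lambda>c. Y2 + c *\<^sub>R ?d) \<inter> ?O"
    then obtain c where c: "p = chart (3/5 - 4 * c) (5 * c) (24/5 - 32 * c)" unfolding line by auto
    have e: "T p + Z p / 8 = c + 3/5" by (simp add: c diff_divide_distrib)
    have "1/2 < T p + Z p / 8" "\<bar>T p + Z p / 8 - 1/2\<bar> < 1/4" using p supp_bounds[of p] by auto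
    then have b: "1/2 < c + 3/5" "c + 3/5 < 3/4" unfolding e abs_less_iff by linarith+
    then have "p \<in> finger" unfolding finger_def
      by (intro image_eqI[of _ _ "c + 3/5"]) (auto simp: c chart_eq_iff tent_def abs_if)
    then show "p \<in> D' \<inter> ?O" using p D'_eq by blast
  qed
  then show ?thesis
    by (rule straight_atI[OF op Y2 finger_direction_nonzero, rotated]) simp
qed

lemma straight_off:
  assumes "a \<notin> csupp" "straight_at D a"
  shows "straight_at D' a"
proof -
  obtain d r where d: "d \<noteq> 0" "r > 0" "D \<inter> ball a r = range (\<lambda>t. a + t *\<^sub>R d) \<inter> ball a r"
    using assms(2) unfolding straight_at_def by blast
  have "D' \<inter> (ball a r - csupp) = D \<inter> (ball a r - csupp)"
    using D'_off supp_csupp by blast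
  also have "\<dots> = range (\<lambda>t. a + t *\<^sub>R d) \<inter> (ball a r - csupp)"
    using d(3) by blast
  finally have eq: "D' \<inter> (ball a r - csupp) = range (\<lambda>t. a + t *\<^sub>R d) \<inter> (ball a r - csupp)" .
  show ?thesis
    by (rule straight_atI[OF _ _ d(1) eq]) (use assms(1) d(2) closed_csupp in \<open>auto intro: open_Diff\<close>)
qed

lemma crossing_not_csupp:
  assumes "(a, b) \<in> crossings D" shows "a \<notin> csupp" "b \<notin> csupp"
proof -
  have ab: "S a = S b" "T a = T b" using assms unfolding crossings_coords by auto
  have "a \<notin> csupp \<and> b \<notin> csupp"
  proof (cases "in_window a")
    case True
    then have "a = x" "b = u" using crossing_in_window[OF assms] by auto
    moreover have "x \<notin> csupp" using over_not_csupp[of 0] by (simp add: chart_001)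
    moreover have "u \<notin> csupp" using csupp_bounds(1)[of u] by auto
    ultimately show ?thesis by simp
  next
    case False
    then have "\<not> in_window b" using in_window_cong[OF ab] by simp
    with False show ?thesis using csupp_in_window by blast
  qed
  then show "a \<notin> csupp" "b \<notin> csupp" by auto
qed

lemma no_triple_D':
  assumes abc: "a \<in> D'" "b \<in> D'" "c \<in> D'" and ab: "plane_proj a = plane_proj b"
    and bc: "plane_proj b = plane_proj c"
  shows "a = b \<or> b = c \<or> a = c"
proof (cases "in_window a")
  case False
  have "\<not> in_window b" "\<not> in_window c"
    using False ab bc in_window_cong unfolding plane_proj_eq_iff by metis+
  then have "a \<in> D" "b \<in> D" "c \<in> D" using abc False D'_outside_in_window by auto
  then show ?thesis using link_diagramD(5)[OF D] ab bc by blast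
next
  case True
  have in_window: "in_window b" "in_window c"
    using True ab bc in_window_cong unfolding plane_proj_eq_iff by metis+
  have st: "S a = S b" "T a = T b" "S b = S c" "T b = T c"
    using ab bc unfolding plane_proj_eq_iff by auto
  \<comment> \<open>A point is on the upper strand or its height is determined by its shadow, so three points
    over one shadow have at most two heights.\<close>
  have form: "(T p = 0 \<and> Z p = 1) \<or> Z p = 8 * S p" if "in_window p" "p \<in> D'" for p
    using that by (cases rule: D'_in_window) auto
  have "Z a = Z b \<or> Z b = Z c \<or> Z a = Z c"
    using form[OF True abc(1)] form[OF in_window(1) abc(2)] form[OF in_window(2) abc(3)] st by metis
  then show ?thesis using st coords_eqI by metis
qed

lemma link_diagram_D': "link_diagram D'"
  unfolding link_diagram_def polygonal_link_alt
proof (intro conjI)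
  show "closed_curves D'" by (rule closed_curves_D')
  show "polygonal_set D'" by (rule polygonal_D')
  show "finite (crossings D')" unfolding crossings_D' using link_diagramD(4)[OF D] by simp
  show "\<forall>a\<in>D'. \<forall>b\<in>D'. \<forall>c\<in>D'. plane_proj a = plane_proj b \<and> plane_proj b = plane_proj c
      \<longrightarrow> a = b \<or> b = c \<or> a = c"
    using no_triple_D' by blast
  show "\<forall>(a, b)\<in>crossings D'. straight_at D' a \<and> straight_at D' b"
  proof clarify
    fix a b assume "(a, b) \<in> crossings D'"
    then consider "(a, b) \<in> crossings D" | "a = Y1" "b = X1" | "a = Y2" "b = X2"
      unfolding crossings_D' by auto
    then show "straight_at D' a \<and> straight_at D' b"
    proof cases
      case 1
      then show ?thesis
        using straight_off crossing_not_csupp[OF 1] link_diagramD(6,7)[OF D 1] by blast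
    next
      case 2
      then show ?thesis using straight_Y1 straight_over[of "1/3"] by (simp add: X1_def)
    next
      case 3
      then show ?thesis using straight_Y2 straight_over[of "3/5"] by (simp add: X2_def)
    qed
  qed
qed

section \<open>Coloring the pulled link\<close>

text \<open>
  The piece of the upper strand below the finger, which becomes an arc of its own.
\<close>

definition seg :: "r3 set" where "seg = (\<lambda>s. chart s 0 1) ` {1/3<..<3/5}"
definition cseg :: "r3 set" where "cseg = (\<lambda>s. chart s 0 1) ` {1/3..3/5}"

lemma chart_in_seg: "chart s t z \<in> seg \<longleftrightarrow> t = 0 \<and> z = 1 \<and> 1/3 < s \<and> s < 3/5"
  unfolding seg_def by (auto simp: chart_eq_iff)

lemma segD: "p \<in> seg \<Longrightarrow> T p = 0 \<and> Z p = 1 \<and> 1/3 < S p \<and> S p < 3/5"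
  using chart_in_seg[of "S p" "T p" "Z p"] by simp

lemma csegD: "p \<in> cseg \<Longrightarrow> T p = 0 \<and> Z p = 1 \<and> 1/3 \<le> S p \<and> S p \<le> 3/5"
  unfolding cseg_def by auto

lemma seg_cseg: "seg \<subseteq> cseg" "cseg \<subseteq> seg \<union> {X1, X2}"
proof -
  show "seg \<subseteq> cseg" unfolding seg_def cseg_def by auto
  show "cseg \<subseteq> seg \<union> {X1, X2}"
  proof
    fix p assume "p \<in> cseg"
    then obtain s where "p = chart s 0 1" "1/3 \<le> s" "s \<le> 3/5" unfolding cseg_def by auto
    then show "p \<in> seg \<union> {X1, X2}"
      by (cases "s = 1/3"; cases "s = 3/5") (simp_all add: X1_def X2_def chart_in_seg chart_eq_iff)
  qed
qed

lemma compact_cseg: "compact cseg"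
  unfolding cseg_def by (intro compact_continuous_image continuous_chart continuous_intros) simp

lemma under_D': "snd ` crossings D' = snd ` crossings D \<union> {X1, X2}"
  unfolding crossings_D' by auto

lemma under_in_window: "b \<in> snd ` crossings D \<Longrightarrow> in_window b \<Longrightarrow> b = u"
proof -
  assume "b \<in> snd ` crossings D" "in_window b"
  then obtain a where ab: "(a, b) \<in> crossings D" by auto
  then have "S a = S b" "T a = T b" unfolding crossings_coords by auto
  then have "in_window a" using \<open>in_window b\<close> in_window_cong by blast
  then show "b = u" using crossing_in_window[OF ab] by simp
qed

lemma over_line_not_under: "\<bar>s\<bar> \<le> 4 \<Longrightarrow> chart s 0 1 \<notin> snd ` crossings D"
proof
  assume s: "\<bar>s\<bar> \<le> 4" and "chart s 0 1 \<in> snd ` crossings D"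
  then have "chart s 0 1 = u" by (intro under_in_window) (simp_all add: in_window_def)
  then have "Z (chart s 0 1) = Z u" by simp
  then show False by simp
qed

lemma over_line_arc:
  assumes "C \<in> arcs D" "x \<in> C" "\<bar>s\<bar> \<le> 4"
  shows "chart s 0 1 \<in> C"
proof -
  let ?K = "(\<lambda>s. chart s 0 1) ` {-4..4}"
  have "connected ?K"
    by (intro connected_continuous_image continuous_chart continuous_intros) simp
  moreover have "?K \<subseteq> D - snd ` crossings D"
  proof
    fix y assume "y \<in> ?K"
    then obtain r where "y = chart r 0 1" "\<bar>r\<bar> \<le> 4" by (auto simp: abs_le_iff)
    then show "y \<in> D - snd ` crossings D" using over_line_not_under[of r] over_in_D[of r] by simp
  qed
  moreover have "x \<in> ?K" by (rule image_eqI[of _ _ 0]) (simp_all add: chart_001)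
  ultimately have "?K \<subseteq> C" by (intro connected_subset_arc[OF assms(1) _ _ assms(2)])
  moreover have "s \<in> {-4..4}" using assms(3) by (auto simp: abs_le_iff)
  ultimately show ?thesis by blast
qed

lemma under_line_arc:
  assumes "C \<in> arcs D" "\<forall>\<^sub>F t in at_right 0. u + t *\<^sub>R w \<in> C" "0 < t" "t \<le> 4"
  shows "chart 0 t 0 \<in> C"
proof -
  let ?K = "(\<lambda>t. chart 0 t 0) ` {0<..4}"
  obtain e where e: "e > 0" "\<And>t. 0 < t \<Longrightarrow> t < e \<Longrightarrow> u + t *\<^sub>R w \<in> C"
    using assms(2) unfolding eventually_at_right_field by auto
  define t0 where "t0 = min (e / 2) 4"
  have t0: "0 < t0" "t0 < e" "t0 \<le> 4" using e(1) by (auto simp: t0_def min_def)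
  have "chart 0 t0 0 \<in> C" using e(2)[OF t0(1,2)] by (simp add: chart_def)
  moreover have "chart 0 t0 0 \<in> ?K" using t0 by (intro imageI) auto
  moreover have "connected ?K"
    by (intro connected_continuous_image continuous_chart continuous_intros) simp
  moreover have "?K \<subseteq> D - snd ` crossings D"
  proof clarify
    fix t :: real assume t: "t \<in> {0<..4}"
    then have w: "in_window (chart 0 t 0)" by (simp add: in_window_def)
    then have "chart 0 t 0 \<in> D" by (simp add: D_in_window)
    moreover have "chart 0 t 0 \<notin> snd ` crossings D"
    proof
      assume "chart 0 t 0 \<in> snd ` crossings D"
      then have "T (chart 0 t 0) = T u" using under_in_window[OF _ w] by simp
      then show False using t by simp
    qed
    ultimately show "chart 0 t 0 \<in> D - snd ` crossings D" by simp
  qed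
  ultimately have "?K \<subseteq> C" using connected_subset_arc[OF assms(1)] by blast
  moreover have "t \<in> {0<..4}" using assms(3,4) by simp
  ultimately show ?thesis by blast
qed

lemma push_over: "push (chart s 0 1) = chart s 0 1"
  using push_off over_not_csupp supp_csupp by blast

lemma push_crossing:
  assumes "(a, b) \<in> crossings D" shows "push a = a" "push b = b"
  using crossing_not_csupp[OF assms] push_off supp_csupp by blast+

text \<open>
  Off the support, a point of the new link can only come from itself.
\<close>

lemma push_eq_off:
  assumes "push y = p" "p \<notin> csupp" shows "y = p"
proof -
  have hp: "push p = p" by (rule push_off) (use assms(2) supp_csupp in blast)
  have "push y = push p" unfolding hp by (rule assms(1))
  then show ?thesis using inj_push by (simp add: inj_def)
qed

text \<open>
  The new undercrossings include the old ones, so pulling back an arc of the new diagram gives a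
  connected set without old undercrossings.
\<close>

lemma arc_D'_lift:
  assumes "B' \<in> arcs D'"
  obtains A0 where "A0 \<in> arcs D" "B' \<subseteq> push ` A0"
proof -
  obtain g where g: "homeomorphism UNIV UNIV push g" using push_homeo by blast
  have gh: "g (push y) = y" "push (g y) = y" for y using g by (auto simp: homeomorphism_def)
  have "continuous_on B' g" using g continuous_on_subset by (auto simp: homeomorphism_def)
  then have conn: "connected (g ` B')" using arcsD(4)[OF assms] by (intro connected_continuous_image)
  have sub: "g ` B' \<subseteq> D - snd ` crossings D"
  proof
    fix y assume "y \<in> g ` B'"
    then obtain q where q: "q \<in> B'" "y = g q" by blast
    then have qD: "q \<in> D'" "q \<notin> snd ` crossings D'" using arcsD[OF assms] by blast+
    then obtain y0 where "y0 \<in> D" "q = push y0" unfolding D'_def by blast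
    then have "y = y0" using q(2) gh(1)[of y0] by metis
    then have y: "y \<in> D" "push y = q" using \<open>y0 \<in> D\<close> \<open>q = push y0\<close> by simp_all
    have "y \<notin> snd ` crossings D"
    proof
      assume "y \<in> snd ` crossings D"
      then obtain b where "(b, y) \<in> crossings D" by auto
      then have "push y = y" by (rule push_crossing(2))
      then show False using y(2) qD(2) \<open>y \<in> snd ` crossings D\<close> under_D' by simp
    qed
    with y show "y \<in> D - snd ` crossings D" by simp
  qed
  have "D - snd ` crossings D \<noteq> {}"
    using over_in_D[of 0] over_line_not_under[of 0] by auto
  from exists_component_superset[OF sub this conn]
  obtain A0 where "A0 \<in> components (D - snd ` crossings D)" "g ` B' \<subseteq> A0"
    by (elim exE conjE)
  moreover have "B' \<subseteq> push ` A0"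
  proof
    fix q assume "q \<in> B'"
    then have "g q \<in> A0" using \<open>g ` B' \<subseteq> A0\<close> by blast
    then have "push (g q) \<in> push ` A0" by (rule imageI)
    then show "q \<in> push ` A0" by (simp add: gh)
  qed
  ultimately show ?thesis using that unfolding arcs_def by blast
qed

text \<open>
  The piece is relatively open and closed in the new link without its undercrossings.
\<close>

lemma arc_meets_seg:
  assumes B': "B' \<in> arcs D'" and y: "y \<in> B'" "y \<in> seg"
  shows "B' \<subseteq> seg"
proof -
  define seg_box where "seg_box = {p. 1/3 < S p \<and> S p < 3/5 \<and> \<bar>T p\<bar> < 4 \<and> 1/2 < Z p \<and> Z p < 2}"
  have "open seg_box" unfolding seg_box_def by (rule open_box)
  have D'O1: "p \<in> seg" if p: "p \<in> D'" "p \<in> seg_box" for p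
  proof -
    have "in_window p" using p by (simp add: seg_box_def in_window_def)
    then show ?thesis using p(1)
    proof (cases rule: D'_in_window)
      case over
      then have "chart (S p) (T p) (Z p) \<in> seg" using p(2) unfolding chart_in_seg by (simp add: seg_box_def)
      then show ?thesis by simp
    qed (use p(2) in \<open>auto simp: seg_box_def\<close>)
  qed
  have segO1: "seg \<subseteq> seg_box" using segD unfolding seg_box_def by fastforce
  have B'_not: "B' \<inter> {X1, X2} = {}" "B' \<subseteq> D'" using arcsD[OF B'] under_D' by auto
  have "seg_box \<inter> B' = {} \<or> (- cseg) \<inter> B' = {}"
  proof (rule connectedD[OF arcsD(4)[OF B'] \<open>open seg_box\<close>])
    show "open (- cseg)" using compact_cseg by (simp add: compact_imp_closed open_Compl)
    show "seg_box \<inter> - cseg \<inter> B' = {}" using D'O1 seg_cseg(1) B'_not(2) by blast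
    show "B' \<subseteq> seg_box \<union> - cseg" using seg_cseg(2) segO1 B'_not(1) by blast
  qed
  then have "B' \<subseteq> cseg" using y segO1 by blast
  then show ?thesis using seg_cseg(2) B'_not(1) by blast
qed

text \<open>
  Near a new undercrossing the link is the upper strand, so the direction in which the two arcs
  leave is a multiple of \<open>v\<close>. The bound \<open>1/100\<close> keeps the points closer to the undercrossing than to
  the other end of the piece.
\<close>

lemma under_arcs_new:
  assumes X: "\<bar>s\<bar> < 3" and ua: "under_arcs (chart s 0 1) A' B'" and AB: "A' \<in> arcs D'" "B' \<in> arcs D'"
  obtains \<beta> where "\<beta> \<noteq> 0" "\<bar>\<beta>\<bar> < 1/100" "chart (s + \<beta>) 0 1 \<in> A'" "chart (s - \<beta>) 0 1 \<in> B'"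
proof -
  obtain d where d: "d \<noteq> 0"
    "\<forall>\<^sub>F t in at_right 0. chart s 0 1 + t *\<^sub>R d \<in> A' \<and> chart s 0 1 - t *\<^sub>R d \<in> B'"
    using ua unfolding under_arcs_def by blast
  have "((\<lambda>t. chart s 0 1 + t *\<^sub>R d) \<longlongrightarrow> chart s 0 1 + 0 *\<^sub>R d) (at_right 0)" by (intro tendsto_intros)
  then have "((\<lambda>t. chart s 0 1 + t *\<^sub>R d) \<longlongrightarrow> chart s 0 1) (at_right 0)" by simp
  then have "\<forall>\<^sub>F t in at_right 0. chart s 0 1 + t *\<^sub>R d \<in> over_box"
    by (rule topological_tendstoD) (use X in \<open>simp_all add: open_over_box over_in_over_box\<close>)
  then have "\<forall>\<^sub>F t in at_right 0. chart s 0 1 + t *\<^sub>R d \<in> over_box \<and> chart s 0 1 + t *\<^sub>R d \<in> A' \<and>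
      chart s 0 1 - t *\<^sub>R d \<in> B'"
    using d(2) by eventually_elim simp
  then obtain e where e: "e > 0" "\<And>t. 0 < t \<Longrightarrow> t < e \<Longrightarrow> chart s 0 1 + t *\<^sub>R d \<in> over_box \<and>
      chart s 0 1 + t *\<^sub>R d \<in> A' \<and> chart s 0 1 - t *\<^sub>R d \<in> B'"
    unfolding eventually_at_right_field by auto
  have "chart s 0 1 + (e / 2) *\<^sub>R d \<in> D'" "chart s 0 1 + (e / 2) *\<^sub>R d \<in> over_box"
    using e(1) e(2)[of "e / 2"] arcsD(2)[OF AB(1)] by auto
  then obtain s1 where "chart s 0 1 + (e / 2) *\<^sub>R d = chart s1 0 1" using D'_over_box(1) by metis
  also have "chart s1 0 1 = chart s 0 1 + (s1 - s) *\<^sub>R v" by (simp add: chart_add_v)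
  finally have hd: "(e / 2) *\<^sub>R d = (s1 - s) *\<^sub>R v" by simp
  have "d = inverse (e / 2) *\<^sub>R ((e / 2) *\<^sub>R d)" using e(1) by simp
  also have "\<dots> = (inverse (e / 2) * (s1 - s)) *\<^sub>R v" unfolding hd by simp
  finally obtain \<alpha> where \<alpha>: "d = \<alpha> *\<^sub>R v" by blast
  then have "\<alpha> \<noteq> 0" using d(1) by auto
  define t where "t = min (e / 2) (1 / (200 * \<bar>\<alpha>\<bar>))"
  have t: "0 < t" "t < e" using e(1) \<open>\<alpha> \<noteq> 0\<close> by (auto simp: t_def min_def)
  have "\<bar>\<alpha>\<bar> * t \<le> \<bar>\<alpha>\<bar> * (1 / (200 * \<bar>\<alpha>\<bar>))" by (intro mult_left_mono) (simp_all add: t_def)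
  also have "\<dots> = 1/200" using \<open>\<alpha> \<noteq> 0\<close> by simp
  finally have small: "\<bar>t * \<alpha>\<bar> < 1/100" using t by (simp add: abs_mult mult.commute)
  show ?thesis
  proof (rule that[of "t * \<alpha>"])
    show "t * \<alpha> \<noteq> 0" using t \<open>\<alpha> \<noteq> 0\<close> by simp
    show "\<bar>t * \<alpha>\<bar> < 1/100" by (rule small)
    show "chart (s + t * \<alpha>) 0 1 \<in> A'" using e(2)[OF t] by (simp add: \<alpha> chart_add_v)
    have "chart s 0 1 - t *\<^sub>R d = chart s 0 1 + (- (t * \<alpha>)) *\<^sub>R v" by (simp add: \<alpha>)
    also have "\<dots> = chart (s - t * \<alpha>) 0 1" by (simp only: chart_add_v) simp
    finally show "chart (s - t * \<alpha>) 0 1 \<in> B'" using e(2)[OF t] by simp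
  qed
qed

text \<open>
  The old arc that a new arc comes from is unique, since \<open>push\<close> is injective and arcs are disjoint.
  It also exists for the piece below the finger, whose color has to be changed.
\<close>

definition recolor :: "int \<Rightarrow> (r3 set \<Rightarrow> int) \<Rightarrow> r3 set \<Rightarrow> int" where
  "recolor new c B' = (if B' \<subseteq> seg then new else c (SOME A0. A0 \<in> arcs D \<and> B' \<subseteq> push ` A0))"

lemma recolor_seg:
  assumes "B' \<in> arcs D'" "y \<in> B'" "y \<in> seg" shows "recolor new c B' = new"
  using arc_meets_seg[OF assms] by (simp add: recolor_def)

lemma recolor_old:
  assumes B': "B' \<in> arcs D'" and y: "push y \<in> B'" "push y \<notin> seg" "y \<in> A0" "A0 \<in> arcs D"
  shows "recolor new c B' = c A0"
proof -
  obtain A1 where "A1 \<in> arcs D \<and> B' \<subseteq> push ` A1" using arc_D'_lift[OF B'] by metis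
  then have A1: "(SOME A0. A0 \<in> arcs D \<and> B' \<subseteq> push ` A0) \<in> arcs D \<and>
      B' \<subseteq> push ` (SOME A0. A0 \<in> arcs D \<and> B' \<subseteq> push ` A0)" (is "?A \<in> _ \<and> _")
    by (rule someI[of "\<lambda>A0. A0 \<in> arcs D \<and> B' \<subseteq> push ` A0"])
  then have "push y \<in> push ` ?A" using y(1) by blast
  then have "y \<in> ?A" using inj_push by (simp add: inj_image_mem_iff)
  then have "?A = A0" using arcs_disjoint A1 y(3,4) by blast
  moreover have "\<not> B' \<subseteq> seg" using y(1,2) by blast
  ultimately show ?thesis by (simp add: recolor_def)
qed

text \<open>
  At each end of the piece, one of the two arcs is the piece and the other is a rest of the old arc \<open>C\<close>.
\<close>

lemma recolor_new_crossing:
  assumes s: "s = 1/3 \<or> s = 3/5" and C: "C \<in> arcs D" "x \<in> C"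
    and AB: "A' \<in> arcs D'" "B' \<in> arcs D'" "under_arcs (chart s 0 1) A' B'"
  shows "(recolor new c A' = new \<and> recolor new c B' = c C) \<or>
    (recolor new c A' = c C \<and> recolor new c B' = new)"
proof -
  have s3: "\<bar>s\<bar> < 3" using s by auto
  obtain \<beta> where \<beta>: "\<beta> \<noteq> 0" "\<bar>\<beta>\<bar> < 1/100" "chart (s + \<beta>) 0 1 \<in> A'" "chart (s - \<beta>) 0 1 \<in> B'"
    using under_arcs_new[OF s3 AB(3,1,2)] by blast
  have b: "- 1/100 < \<beta>" "\<beta> < 1/100" using \<beta>(2) by (simp_all add: abs_if split: if_splits)
  have old: "recolor new c X = c C" if "X \<in> arcs D'" "chart r 0 1 \<in> X" "chart r 0 1 \<notin> seg" "\<bar>r\<bar> \<le> 4" for X r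
    using that recolor_old[OF that(1), of "chart r 0 1" C] C over_line_arc push_over by simp
  have r4: "\<bar>s + \<beta>\<bar> \<le> 4" "\<bar>s - \<beta>\<bar> \<le> 4" using s b by (auto simp: abs_le_iff)
  have "chart (s + \<beta>) 0 1 \<in> seg \<and> chart (s - \<beta>) 0 1 \<notin> seg \<or> chart (s + \<beta>) 0 1 \<notin> seg \<and> chart (s - \<beta>) 0 1 \<in> seg"
    unfolding chart_in_seg using s b \<beta>(1) by (cases "\<beta> > 0") auto
  then show ?thesis
    using recolor_seg[OF AB(1) \<beta>(3)] recolor_seg[OF AB(2) \<beta>(4)]
      old[OF AB(1) \<beta>(3) _ r4(1)] old[OF AB(2) \<beta>(4) _ r4(2)] by blast
qed

text \<open>
  Near an old undercrossing nothing was moved or recolored, so the coloring condition there is the old one.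
\<close>

lemma under_arcs_old:
  assumes ab: "(a, b) \<in> crossings D" and AB: "A' \<in> arcs D'" "B' \<in> arcs D'" "under_arcs b A' B'"
  obtains A0 B0 where "A0 \<in> arcs D" "B0 \<in> arcs D" "under_arcs b A0 B0"
    "recolor new c A' = c A0" "recolor new c B' = c B0"
proof -
  obtain d where d: "d \<noteq> 0" "\<forall>\<^sub>F t in at_right 0. b + t *\<^sub>R d \<in> A' \<and> b - t *\<^sub>R d \<in> B'"
    using AB(3) unfolding under_arcs_def by blast
  let ?W = "- csupp \<inter> - cseg"
  have "open ?W" using closed_csupp compact_cseg by (simp add: compact_imp_closed open_Compl open_Int)
  have "b \<notin> cseg"
  proof
    assume "b \<in> cseg"
    then obtain s where "b = chart s 0 1" "1/3 \<le> s" "s \<le> 3/5" unfolding cseg_def by auto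
    moreover have "b \<in> snd ` crossings D" using ab by force
    ultimately show False using over_line_not_under[of s] by simp
  qed
  then have "b \<in> ?W" using crossing_not_csupp(2)[OF ab] by simp
  have "((\<lambda>t. b + t *\<^sub>R d) \<longlongrightarrow> b + 0 *\<^sub>R d) (at_right 0)"
    "((\<lambda>t. b - t *\<^sub>R d) \<longlongrightarrow> b - 0 *\<^sub>R d) (at_right 0)" by (intro tendsto_intros)+
  then have "((\<lambda>t. b + t *\<^sub>R d) \<longlongrightarrow> b) (at_right 0)" "((\<lambda>t. b - t *\<^sub>R d) \<longlongrightarrow> b) (at_right 0)"
    by simp_all
  then have "\<forall>\<^sub>F t in at_right 0. b + t *\<^sub>R d \<in> ?W" "\<forall>\<^sub>F t in at_right 0. b - t *\<^sub>R d \<in> ?W"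
    using topological_tendstoD \<open>open ?W\<close> \<open>b \<in> ?W\<close> by blast+
  then have ev: "\<forall>\<^sub>F t in at_right 0. (b + t *\<^sub>R d \<in> ?W \<and> b + t *\<^sub>R d \<in> A') \<and>
      (b - t *\<^sub>R d \<in> ?W \<and> b - t *\<^sub>R d \<in> B')"
    using d(2) by eventually_elim simp
  then obtain e where e: "e > 0" "\<And>t. 0 < t \<Longrightarrow> t < e \<Longrightarrow>
      (b + t *\<^sub>R d \<in> ?W \<and> b + t *\<^sub>R d \<in> A') \<and> (b - t *\<^sub>R d \<in> ?W \<and> b - t *\<^sub>R d \<in> B')"
    unfolding eventually_at_right_field by auto
  have lift: "y \<in> X0 \<and> push y = y" if "y \<in> ?W" "y \<in> X" "X \<subseteq> push ` X0" for y X X0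
  proof -
    have "y \<in> push ` X0" using that by blast
    then obtain y0 where "y0 \<in> X0" "push y0 = y" by auto
    moreover have "y \<notin> csupp" using that(1) by simp
    ultimately show ?thesis using push_eq_off[of y0 y] by simp
  qed
  have not_seg: "y \<notin> seg" if "y \<in> ?W" for y using that seg_cseg(1) by blast
  obtain A0 where A0: "A0 \<in> arcs D" "A' \<subseteq> push ` A0" using arc_D'_lift[OF AB(1)] .
  obtain B0 where B0: "B0 \<in> arcs D" "B' \<subseteq> push ` B0" using arc_D'_lift[OF AB(2)] .
  have "\<forall>\<^sub>F t in at_right 0. b + t *\<^sub>R d \<in> A0 \<and> b - t *\<^sub>R d \<in> B0"
    using ev by (rule eventually_mono) (use lift A0(2) B0(2) in blast)
  then have "under_arcs b A0 B0" using d(1) unfolding under_arcs_def by blast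
  have e2: "0 < e / 2" "e / 2 < e" using e(1) by auto
  define y z where "y = b + (e / 2) *\<^sub>R d" and "z = b - (e / 2) *\<^sub>R d"
  have yz: "y \<in> ?W" "y \<in> A'" "z \<in> ?W" "z \<in> B'" using e(2)[OF e2] by (simp_all add: y_def z_def)
  have "recolor new c A' = c A0"
    using recolor_old[OF AB(1), of y A0] lift[OF yz(1,2) A0(2)] yz(2) not_seg[OF yz(1)] A0(1) by simp
  moreover have "recolor new c B' = c B0"
    using recolor_old[OF AB(2), of z B0] lift[OF yz(3,4) B0(2)] yz(4) not_seg[OF yz(3)] B0(1) by simp
  ultimately show ?thesis using that A0(1) B0(1) \<open>under_arcs b A0 B0\<close> by blast
qed

lemma finger_arc:
  assumes A: "A0 \<in> arcs D" "\<forall>\<^sub>F t in at_right 0. u + t *\<^sub>R w \<in> A0"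
    and Y: "Y = Y1 \<or> Y = Y2" and C': "C' \<in> arcs D'" "Y \<in> C'"
  shows "recolor new c C' = c A0"
proof -
  obtain t where t: "Y = chart (tent t) (t - tent t) (8 * tent t)" "1/4 < t" "t < 3/4" "tent t > 1/8"
    using Y
  proof
    assume "Y = Y1" then show ?thesis using that[of "1/3"] Y_tent(1) tent_fixed_values(1) by simp
  next
    assume "Y = Y2" then show ?thesis using that[of "3/5"] Y_tent(2) tent_fixed_values(2) by simp
  qed
  have "push (chart 0 t 0) = Y" using push_under t by simp
  moreover have "chart 0 t 0 \<in> A0" using t by (intro under_line_arc[OF A]) auto
  moreover have "Y \<notin> seg" unfolding t(1) chart_in_seg using t(4) by simp
  ultimately show ?thesis using recolor_old[OF C'(1), of "chart 0 t 0" A0] C'(2) A(1) by simp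
qed

text \<open>
  Both new crossings have the finger on top, with the color of \<open>A0\<close>, and the piece and the rest of
  \<open>C\<close> below, so their condition is the definition of the new color. No old color is lost, because each
  old arc keeps a point that is not on the piece; for \<open>C\<close> this is the point \<open>x\<close>.
\<close>

lemma color_step:
  assumes p: "p > 0" and c: "coloring p D c" and C: "C \<in> arcs D" "x \<in> C"
    and A: "A0 \<in> arcs D" "\<forall>\<^sub>F t in at_right 0. u + t *\<^sub>R w \<in> A0"
  obtains c' C' A' B' where "coloring p D' c'" "c ` arcs D \<subseteq> c' ` arcs D'"
    "C' \<in> arcs D'" "A' \<in> arcs D'" "B' \<in> arcs D'" "Y1 \<in> C'" "under_arcs X1 A' B'"
    "c' C' = c A0" "c' A' = (2 * c A0 - c C) mod int p"
proof -
  define new where "new = (2 * c A0 - c C) mod int p"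
  define c' where "c' = recolor new c"
  have new: "new \<in> {0..<int p}" using p by (simp add: new_def)
  have cval: "c X \<in> {0..<int p}" if "X \<in> arcs D" for X
    using c that by (simp add: coloring_def)
  have c'val: "c' B' \<in> {0..<int p}" if B': "B' \<in> arcs D'" for B'
  proof (cases "B' \<subseteq> seg")
    case True
    then show ?thesis using new by (simp add: c'_def recolor_def)
  next
    case False
    then obtain q where q: "q \<in> B'" "q \<notin> seg" by blast
    obtain A1 where A1: "A1 \<in> arcs D" "B' \<subseteq> push ` A1" using arc_D'_lift[OF B'] .
    then obtain y where "y \<in> A1" "q = push y" using q by blast
    then have "c' B' = c A1" unfolding c'_def using recolor_old[OF B', of y A1] q A1(1) by simp
    then show ?thesis using cval[OF A1(1)] by simp
  qed
  have newc: "[2 * c A0 = new + c C] (mod int p)" "[2 * c A0 = c C + new] (mod int p)"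
    by (simp_all add: new_def cong_def mod_simps)
  have new_cross: "[2 * c' K = c' A1 + c' B1] (mod int p)"
    if "Y = Y1 \<and> X = chart (1/3) 0 1 \<or> Y = Y2 \<and> X = chart (3/5) 0 1"
      "K \<in> arcs D'" "A1 \<in> arcs D'" "B1 \<in> arcs D'" "Y \<in> K" "under_arcs X A1 B1" for Y X K A1 B1
  proof -
    have "c' K = c A0" unfolding c'_def using finger_arc[OF A _ that(2,5)] that(1) by blast
    moreover have "(c' A1 = new \<and> c' B1 = c C) \<or> (c' A1 = c C \<and> c' B1 = new)"
      unfolding c'_def using recolor_new_crossing[OF _ C that(3,4)] that(1,6) by metis
    ultimately show ?thesis using newc by auto
  qed
  have col: "coloring p D' c'"
    unfolding coloring_def
  proof (intro conjI ballI)
    fix K assume "K \<in> arcs D'"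
    then show "c' K \<in> {0..<int p}" by (rule c'val)
  next
    fix ab assume ab: "ab \<in> crossings D'"
    show "case ab of (a, b) \<Rightarrow> \<forall>K\<in>arcs D'. \<forall>A1\<in>arcs D'. \<forall>B1\<in>arcs D'.
        a \<in> K \<and> under_arcs b A1 B1 \<longrightarrow> [2 * c' K = c' A1 + c' B1] (mod int p)"
    proof (clarify)
      fix a b K A1 B1
      assume eq: "ab = (a, b)" and K: "K \<in> arcs D'" "A1 \<in> arcs D'" "B1 \<in> arcs D'"
        and aK: "a \<in> K" and ua: "under_arcs b A1 B1"
      from ab eq consider "(a, b) \<in> crossings D" | "a = Y1" "b = chart (1/3) 0 1" | "a = Y2" "b = chart (3/5) 0 1"
        unfolding crossings_D' X1_def X2_def by auto
      then show "[2 * c' K = c' A1 + c' B1] (mod int p)"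
      proof cases
        case 1
        obtain K0 where K0: "K0 \<in> arcs D" "a \<in> K0"
          using arc_through crossingsD(1)[OF 1] over_not_under[OF D 1] by blast
        have "a \<notin> seg"
        proof
          assume "a \<in> seg"
          note sd = segD[OF this]
          then have "a = x" using crossing_in_window[OF 1] by (auto simp: in_window_def)
          then show False using sd by simp
        qed
        then have "c' K = c K0"
          unfolding c'_def using recolor_old[OF K(1), of a K0] push_crossing(1)[OF 1] aK K0 by simp
        moreover obtain A2 B2 where "A2 \<in> arcs D" "B2 \<in> arcs D" "under_arcs b A2 B2"
          "c' A1 = c A2" "c' B1 = c B2"
          unfolding c'_def using under_arcs_old[OF 1 K(2,3) ua] by metis
        ultimately show ?thesis
          using c 1 K0 unfolding coloring_def by fastforce
      next
        case 2
        show ?thesis by (rule new_cross[OF _ K aK ua]) (simp add: 2)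
      next
        case 3
        show ?thesis by (rule new_cross[OF _ K aK ua]) (simp add: 3)
      qed
    qed
  qed
  have arc_at: "\<exists>B'\<in>arcs D'. push y \<in> B' \<and> c' B' = c A1"
    if A1: "A1 \<in> arcs D" "y \<in> A1" and yc: "push y \<notin> cseg" for A1 y
  proof -
    have "y \<in> D" "y \<notin> snd ` crossings D" using arcsD[OF A1(1)] A1(2) by blast+
    have "push y \<in> D'" using \<open>y \<in> D\<close> by (simp add: D'_def)
    moreover have "push y \<notin> snd ` crossings D'"
    proof
      assume "push y \<in> snd ` crossings D'"
      moreover have "X1 \<in> cseg" "X2 \<in> cseg" by (simp_all add: X1_def X2_def cseg_def)
      ultimately have "push y \<in> snd ` crossings D" using yc under_D' by auto
      then obtain b where "(b, push y) \<in> crossings D" by auto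
      then have "push (push y) = push y" by (rule push_crossing(2))
      then have "push y = y" using inj_push by (simp add: inj_eq)
      then show False using \<open>push y \<in> snd ` crossings D\<close> \<open>y \<notin> snd ` crossings D\<close> by simp
    qed
    ultimately obtain B' where B': "B' \<in> arcs D'" "push y \<in> B'" using arc_through by metis
    moreover have "push y \<notin> seg" using yc seg_cseg(1) by blast
    ultimately show ?thesis unfolding c'_def using recolor_old[OF B' _ A1(2,1)] by metis
  qed
  have sub: "c ` arcs D \<subseteq> c' ` arcs D'"
  proof clarify
    fix A1 assume A1: "A1 \<in> arcs D"
    have "\<exists>y\<in>A1. push y \<notin> cseg"
    proof (cases "A1 = C")
      case True
      have "push x = x" using push_crossing(1)[OF xu] .
      moreover have "x \<notin> cseg" using csegD[of x] by auto
      ultimately show ?thesis using True C(2) by (intro bexI[of _ x]) simp_all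
    next
      case False
      obtain y where y: "y \<in> A1" using arcsD(1)[OF A1] by blast
      have "push y \<notin> cseg"
      proof
        assume "push y \<in> cseg"
        then obtain s where s: "push y = chart s 0 1" "1/3 \<le> s" "s \<le> 3/5" unfolding cseg_def by auto
        then have "y = chart s 0 1" using push_eq_off[OF s(1) over_not_csupp] by simp
        then have "y \<in> C" using over_line_arc[OF C, of s] s by simp
        then show False using arcs_disjoint[OF A1 C(1) y] False by simp
      qed
      then show ?thesis using y by blast
    qed
    then obtain B' where "B' \<in> arcs D'" "c' B' = c A1" using arc_at[OF A1] by metis
    then show "c A1 \<in> c' ` arcs D'" by (metis imageI)
  qed
  have cr: "(Y1, X1) \<in> crossings D'" using crossings_D' by simp
  obtain A' B' where AB: "A' \<in> arcs D'" "B' \<in> arcs D'" "under_arcs X1 A' B'"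
    using under_arcs_exist[OF link_diagram_D' cr] by metis
  have "(c' A' = new \<and> c' B' = c C) \<or> (c' A' = c C \<and> c' B' = new)"
    unfolding c'_def using recolor_new_crossing[OF _ C AB(1,2)] AB(3) X1_def by metis
  then obtain A'' B'' where AB': "A'' \<in> arcs D'" "B'' \<in> arcs D'" "under_arcs X1 A'' B''" "c' A'' = new"
    using AB under_arcs_sym by metis
  obtain C' where C': "C' \<in> arcs D'" "Y1 \<in> C'"
    using arc_through crossingsD(1)[OF cr] over_not_under[OF link_diagram_D' cr] by metis
  have "c' C' = c A0" unfolding c'_def using finger_arc[OF A _ C'] by blast
  with that[OF col sub C'(1) AB'(1,2) C'(2) AB'(3)] AB'(4) show ?thesis by (simp add: new_def)
qed

end

section \<open>All residues are used\<close>

text \<open>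
  The conclusion has the form of the hypotheses, with the colors of \<open>C\<close> and \<open>A\<close>, two consecutive
  terms of the progression, replaced by the next consecutive pair, so the step can be iterated.
\<close>

lemma add_color:
  assumes D: "link_diagram D" and p: "p > 0" and c: "coloring p D c"
    and xu: "(x, u) \<in> crossings D" and C: "C \<in> arcs D" "x \<in> C"
    and AB: "A \<in> arcs D" "under_arcs u A B"
  obtains D' c' x' u' C' A' B' where "ambient_isotopic D D'" "link_diagram D'" "coloring p D' c'"
    "c ` arcs D \<subseteq> c' ` arcs D'" "(x', u') \<in> crossings D'" "C' \<in> arcs D'" "x' \<in> C'"
    "A' \<in> arcs D'" "B' \<in> arcs D'" "under_arcs u' A' B'" "c' C' = c A" "c' A' = (2 * c A - c C) mod int p"
proof -
  obtain v w where ch: "crossing_chart D x u v w" and ev: "\<forall>\<^sub>F t in at_right 0. u + t *\<^sub>R w \<in> A"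
    using crossing_chart_exists[OF D xu AB(2,1)] .
  interpret crossing_chart D x u v w by (rule ch)
  obtain c' C' A' B' where *: "coloring p D' c'" "c ` arcs D \<subseteq> c' ` arcs D'"
    "C' \<in> arcs D'" "A' \<in> arcs D'" "B' \<in> arcs D'" "Y1 \<in> C'" "under_arcs X1 A' B'"
    "c' C' = c A" "c' A' = (2 * c A - c C) mod int p"
    using color_step[OF p c C AB(1) ev] .
  have "(Y1, X1) \<in> crossings D'" using crossings_D' by simp
  from that[OF push_isotopic link_diagram_D' *(1,2) this *(3,6,4,5,7,8,9)] show ?thesis .
qed

lemma progression_of_colors:
  assumes D: "link_diagram D" and p: "p > 0" and c: "coloring p D c"
    and xu: "(x, u) \<in> crossings D" and C: "C \<in> arcs D" "x \<in> C"
    and AB: "A \<in> arcs D" "under_arcs u A B"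
  shows "\<exists>D' c' x' u' C' A' B'. ambient_isotopic D D' \<and> link_diagram D' \<and> coloring p D' c' \<and>
    (\<forall>j\<le>n + 1. (c C + int j * (c A - c C)) mod int p \<in> c' ` arcs D') \<and>
    (x', u') \<in> crossings D' \<and> C' \<in> arcs D' \<and> x' \<in> C' \<and> A' \<in> arcs D' \<and> under_arcs u' A' B' \<and>
    [c' C' = c C + int n * (c A - c C)] (mod int p) \<and>
    [c' A' = c C + int (n + 1) * (c A - c C)] (mod int p)"
proof (induction n)
  case 0
  have iso: "ambient_isotopic D D"
    using lift_isotopy[of "\<lambda>_. 0" D] by simp
  have vals: "c C \<in> {0..<int p}" "c A \<in> {0..<int p}"
    using c C(1) AB(1) unfolding coloring_def by blast+
  have used: "(c C + int j * (c A - c C)) mod int p \<in> c ` arcs D" if j: "j \<le> 0 + 1" for j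
  proof -
    consider "j = 0" | "j = 1" using j by linarith
    then show ?thesis
    proof cases
      case 1
      then have "(c C + int j * (c A - c C)) mod int p = c C" using vals(1) by simp
      then show ?thesis using C(1) by simp
    next
      case 2
      then have "(c C + int j * (c A - c C)) mod int p = c A" using vals(2) by simp
      then show ?thesis using AB(1) by simp
    qed
  qed
  show ?case
    by (rule exI[of _ D], rule exI[of _ c], rule exI[of _ x], rule exI[of _ u], rule exI[of _ C],
        rule exI[of _ A], rule exI[of _ B])
      (use iso used D c xu C AB in simp)
next
  case (Suc n)
  define a where "a j = c C + int j * (c A - c C)" for j
  obtain D1 c1 x1 u1 C1 A1 B1 where 1: "ambient_isotopic D D1" "link_diagram D1" "coloring p D1 c1"
    "\<forall>j\<le>n + 1. a j mod int p \<in> c1 ` arcs D1"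
    "(x1, u1) \<in> crossings D1" "C1 \<in> arcs D1" "x1 \<in> C1" "A1 \<in> arcs D1" "under_arcs u1 A1 B1"
    "[c1 C1 = a n] (mod int p)" "[c1 A1 = a (n + 1)] (mod int p)"
    using Suc unfolding a_def by metis
  obtain D2 c2 x2 u2 C2 A2 B2 where 2: "ambient_isotopic D1 D2" "link_diagram D2" "coloring p D2 c2"
    "c1 ` arcs D1 \<subseteq> c2 ` arcs D2" "(x2, u2) \<in> crossings D2" "C2 \<in> arcs D2" "x2 \<in> C2"
    "A2 \<in> arcs D2" "B2 \<in> arcs D2" "under_arcs u2 A2 B2" "c2 C2 = c1 A1"
    "c2 A2 = (2 * c1 A1 - c1 C1) mod int p"
    using add_color[OF 1(2) p 1(3) 1(5,6,7,8,9)] .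
  have "[2 * c1 A1 - c1 C1 = 2 * a (n + 1) - a n] (mod int p)"
    by (intro cong_diff cong_mult cong_refl 1(10,11))
  also have "2 * a (n + 1) - a n = a (n + 2)" by (simp add: a_def algebra_simps)
  finally have last: "(2 * c1 A1 - c1 C1) mod int p = a (n + 2) mod int p" by (simp add: cong_def)
  have cA2: "c2 A2 = a (n + 2) mod int p" using 2(12) last by simp
  have "a j mod int p \<in> c2 ` arcs D2" if "j \<le> Suc n + 1" for j
  proof (cases "j \<le> n + 1")
    case True
    then show ?thesis using 1(4) 2(4) by blast
  next
    case False
    then have "j = n + 2" using that by simp
    then show ?thesis using cA2 2(8) by (metis imageI)
  qed
  moreover have "[c2 C2 = a (Suc n)] (mod int p)" using 2(11) 1(11) by simp
  moreover have "[c2 A2 = a (Suc n + 1)] (mod int p)" using cA2 by (simp add: cong_def)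
  ultimately show ?case
    unfolding a_def[symmetric]
    using ambient_isotopic_trans[OF 1(1) 2(1)] 2 by metis
qed

lemma progression_mod_prime:
  fixes a d :: int
  assumes p: "prime p" and d: "\<not> int p dvd d"
  shows "(\<lambda>j. (a + int j * d) mod int p) ` {..<p} = {0..<int p}"
proof (rule card_subset_eq)
  have "p > 0" using p prime_gt_0_nat by blast
  then show "(\<lambda>j. (a + int j * d) mod int p) ` {..<p} \<subseteq> {0..<int p}" by auto
  have "inj_on (\<lambda>j. (a + int j * d) mod int p) {..<p}"
  proof (rule inj_onI)
    fix i j assume ij: "i \<in> {..<p}" "j \<in> {..<p}"
      "(a + int i * d) mod int p = (a + int j * d) mod int p"
    then have "int p dvd (a + int i * d) - (a + int j * d)" by (simp add: mod_eq_dvd_iff)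
    then have "int p dvd (int i - int j) * d" by (simp add: algebra_simps)
    moreover have "prime (int p)" using p by simp
    ultimately have "int p dvd int i - int j" using d prime_dvd_mult_iff by blast
    then have "int i mod int p = int j mod int p" by (simp add: mod_eq_dvd_iff)
    then show "i = j" using ij(1,2) by simp
  qed
  then show "card ((\<lambda>j. (a + int j * d) mod int p) ` {..<p}) = card {0..<int p}"
    by (simp add: card_image)
qed simp

lemma colors_le:
  assumes "coloring p D c" shows "c ` arcs D \<subseteq> {0..<int p}" "card (c ` arcs D) \<le> p"
proof -
  show sub: "c ` arcs D \<subseteq> {0..<int p}" using assms by (auto simp: coloring_def)
  show "card (c ` arcs D) \<le> p" using card_mono[OF _ sub] by simp
qed

lemma max_colors_diagram_le: "max_colors_diagram p D \<le> p"
proof -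
  let ?M = "{card (c ` arcs D) | c. nontrivial_coloring p D c}"
  have le: "m \<le> p" if "m \<in> ?M" for m
    using that colors_le(2) unfolding nontrivial_coloring_def by blast
  show ?thesis
  proof (cases "?M = {}")
    case True
    then show ?thesis unfolding max_colors_diagram_def by (simp only: Sup_nat_empty)
  next
    case False
    then show ?thesis unfolding max_colors_diagram_def by (intro cSup_least le)
  qed
qed

theorem theorem1p1:
  fixes p :: nat and L :: "(real^3) set"
  assumes "prime p" and "odd p"
    and "link L" and "\<not> split_link L"
    and "admits_nontrivial_colorings p L"
  shows "maxcol p L = p"
proof -
  have p: "p > 1" using assms(1) by (rule prime_gt_1_nat)
  obtain D c where "diagram_of D L" and c: "nontrivial_coloring p D c"
    using assms(5) unfolding admits_nontrivial_colorings_def by blast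
  then have D: "link_diagram D" and LD: "ambient_isotopic L D"
    by (auto simp: diagram_of_def)
  have "\<not> split_link D" using split_link_isotopic[OF LD] assms(4) by blast
  then obtain x u C A B where *: "(x, u) \<in> crossings D" "C \<in> arcs D" "A \<in> arcs D" "B \<in> arcs D"
    "x \<in> C" "under_arcs u A B" "c A \<noteq> c C"
    using bichromatic_crossing[OF D _ c] by metis
  have col: "coloring p D c" using c by (simp add: nontrivial_coloring_def)
  have "c A \<in> {0..<int p}" "c C \<in> {0..<int p}" using col *(2,3) by (auto simp: coloring_def)
  then have d: "\<not> int p dvd c A - c C"
    using *(7) by (metis atLeastLessThan_iff mod_eq_dvd_iff mod_pos_pos_trivial)
  obtain D' c' where D': "ambient_isotopic D D'" "link_diagram D'" and c': "coloring p D' c'"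
    and prog: "\<forall>j\<le>p - 2 + 1. (c C + int j * (c A - c C)) mod int p \<in> c' ` arcs D'"
    using progression_of_colors[OF D _ col *(1,2,5,3,6), of "p - 2"] p by auto
  have "{0..<int p} = (\<lambda>j. (c C + int j * (c A - c C)) mod int p) ` {..<p}"
    using progression_mod_prime[OF assms(1) d] by simp
  also have "\<dots> \<subseteq> c' ` arcs D'" using prog p by auto
  finally have all: "c' ` arcs D' = {0..<int p}" using colors_le(1)[OF c'] by blast
  then have card: "card (c' ` arcs D') = p" by simp
  have "nontrivial_coloring p D' c'" using c' card p by (simp add: nontrivial_coloring_def)
  then have mem: "p \<in> {card (c ` arcs D') | c. nontrivial_coloring p D' c}" using card by blast
  have bdd: "bdd_above {card (c ` arcs D') | c. nontrivial_coloring p D' c}"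
    by (rule bdd_aboveI[of _ p]) (use colors_le(2) nontrivial_coloring_def in auto)
  have "p \<le> max_colors_diagram p D'"
    unfolding max_colors_diagram_def by (rule cSup_upper[OF mem bdd])
  then have max: "max_colors_diagram p D' = p" using max_colors_diagram_le by (simp add: order_antisym)
  have dia: "diagram_of D' L" using D' ambient_isotopic_trans[OF LD D'(1)] by (simp add: diagram_of_def)
  show ?thesis
    unfolding maxcol_def
  proof (rule Max_eqI)
    show "finite {max_colors_diagram p D |D. diagram_of D L}"
      by (rule finite_subset[of _ "{..p}"]) (use max_colors_diagram_le in auto)
    show "m \<le> p" if "m \<in> {max_colors_diagram p D |D. diagram_of D L}" for m
      using that max_colors_diagram_le by auto
    show "p \<in> {max_colors_diagram p D |D. diagram_of D L}" using max dia by (metis (mono_tags, lifting) mem_Collect_eq)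
  qed
qed

end
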